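(* Let $m>0$ be given. With $V_{\min}$ and $\mathfrak S_0$ as defined in the context, the following hold. (1) There is $M_0(m)>0$ such that for any $M>M_0(m)$ and any $H_0$ with $V_{\min}(M)<H_0^2<1$, we have $(H_0,M)\in\mathfrak S_0$. (2) For any $\bar M>16m^2$ there is $\delta(m,\bar M)>0$ such that for any $16m^2<M<\bar M$ and any $H_0$ with $V_{\min}(M)<H_0^2<V_{\min}(M)+\delta(m,\bar M)$, we have $(H_0,M)\in\mathfrak S_0$.
   Context: For $R\ge(\frac32+\sqrt2)m$ let $\alpha_0(R)=\frac{2R-m}{2R+m}$, $A_0(R)=(1+\frac m{2R})^2$ (Schwarzschild of mass $m$ in isotropic coordinates), $V_0(R,M)=\alpha_0(R)^2\big(1+\frac{M}{A_0(R)^2R^2}\big)$, and $H_0(R,w,\ell)=\alpha_0(R)\sqrt{1+w^2+\frac{\ell}{A_0(R)^2R^2}}$ for $w\in\mathbb R$, $\ell>0$. $H_0$ always denotes a positive number. For $M>16m^2$, $V_{\min}(M)$ is the (local) minimum of $V_0(\cdot,M)$ on this range of $R$. For $M>16m^2$ and $V_{\min}(M)<H_0^2<1$, let $(\frac32+\sqrt2)m<R_-^0(H_0,M)<R_+^0(H_0,M)$ be the two roots of $V_0(R,M)=H_0^2$ such that the local minimum point lies between them, let $w(R,H_0,M)=\sqrt{\frac{H_0^2}{\alpha_0(R)^2}-1-\frac{M}{A_0(R)^2R^2}}$, and define $\Omega_{\rm Sch}(H_0,M)$ by \[ \frac{\pi}{\Omega_{\rm Sch}(H_0,M)}=\int_{R_-^0(H_0,M)}^{R_+^0(H_0,M)}\frac{A_0(R)H_0}{\alpha_0(R)^2\,w(R,H_0,M)}\,dR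 . \] Let $\mathfrak S_{\rm b}=\{(H_0,M): M>16m^2,\ V_{\min}(M)\le H_0^2<1\}$. For $\mathfrak c>0$, $\mathfrak S_{\mathfrak c}$ is the set of $(H_0,M)\in\mathfrak S_{\rm b}$ such that $(\partial_{H_0}\Omega_{\rm Sch})(H_0,M)<-\mathfrak c$ and, for all $(R,w,\ell)$ with $R\ge(\frac32+\sqrt2)m$, $\ell=M$, $H_0(R,w,\ell)=H_0$, one has $\partial_\ell\big(\Omega_{\rm Sch}(H_0(R,w,\ell),\ell)\big)<-\mathfrak c$, where $\partial_\ell$ is taken at fixed $(R,w)$ (so it equals $(\partial_\ell H_0)(\partial_{H_0}\Omega_{\rm Sch})+\partial_M\Omega_{\rm Sch}$). Finally $\mathfrak S_0=\bigcup_{\mathfrak c>0}\mathfrak S_{\mathfrak c}$. *)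

theory Defs
  imports "HOL-Analysis.Analysis"
begin

definition R_star :: "real \<Rightarrow> real" where
  "R_star m = (3/2 + sqrt 2) * m"

definition alpha0 :: "real \<Rightarrow> real \<Rightarrow> real" where
  "alpha0 m R = (2 * R - m) / (2 * R + m)"

definition A0 :: "real \<Rightarrow> real \<Rightarrow> real" where
  "A0 m R = (1 + m / (2 * R))^2"

definition V0 :: "real \<Rightarrow> real \<Rightarrow> real \<Rightarrow> real" where
  "V0 m R M = (alpha0 m R)^2 * (1 + M / ((A0 m R)^2 * R^2))"

definition H0 :: "real \<Rightarrow> real \<Rightarrow> real \<Rightarrow> real \<Rightarrow> real" where
  "H0 m R w l = alpha0 m R * sqrt (1 + w^2 + l / ((A0 m R)^2 * R^2))"

(* For M > 16 m^2 there is exactly one local minimum point relative to [R_star m, oo).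
   It is also the global minimum point on that range. *)
definition R_min :: "real \<Rightarrow> real \<Rightarrow> real" where
  "R_min m M = (THE R. R \<in> {R_star m..} \<and>
     (\<forall>\<^sub>F x in at R within {R_star m..}. V0 m R M \<le> V0 m x M))"

definition V_min :: "real \<Rightarrow> real \<Rightarrow> real" where
  "V_min m M = V0 m (R_min m M) M"

definition R_minus :: "real \<Rightarrow> real \<Rightarrow> real \<Rightarrow> real" where
  "R_minus m h M = (THE R. R_star m < R \<and> R < R_min m M \<and> V0 m R M = h^2)"

definition R_plus :: "real \<Rightarrow> real \<Rightarrow> real \<Rightarrow> real" where
  "R_plus m h M = (THE R. R_min m M < R \<and> V0 m R M = h^2)"

definition w_of :: "real \<Rightarrow> real \<Rightarrow> real \<Rightarrow> real \<Rightarrow> real" where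
  "w_of m R h M = sqrt (h^2 / (alpha0 m R)^2 - 1 - M / ((A0 m R)^2 * R^2))"

(* The integrand is singular (but integrable) at both endpoints, where w_of vanishes. *)
definition Omega_int :: "real \<Rightarrow> real \<Rightarrow> real \<Rightarrow> real" where
  "Omega_int m h M = pi / integral {R_minus m h M..R_plus m h M}
     (\<lambda>R. A0 m R * h / ((alpha0 m R)^2 * w_of m R h M))"

(* On the circular orbits h^2 = V_min m M the two roots merge and the integral formula
   degenerates; there Omega is extended by its one-sided limit. *)
definition Omega_Sch :: "real \<Rightarrow> real \<Rightarrow> real \<Rightarrow> real" where
  "Omega_Sch m h M =
     (if h^2 = V_min m M then Lim (at_right h) (\<lambda>k. Omega_int m k M) else Omega_int m h M)"

definition S_b :: "real \<Rightarrow> (real \<times> real) set" where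
  "S_b m = {(h, M). 0 < h \<and> M > 16 * m^2 \<and> V_min m M \<le> h^2 \<and> h^2 < 1}"

(* The h-derivative is taken relative to the energies admissible for M, hence it is one-sided
   on the boundary h^2 = V_min m M and the ordinary derivative elsewhere in S_b.  The
   l-derivative needs no such restriction: H0 m R w l is admissible for all l near M. *)
definition S_c :: "real \<Rightarrow> real \<Rightarrow> (real \<times> real) set" where
  "S_c m c = {(h, M). (h, M) \<in> S_b m \<and>
     (\<exists>D. ((\<lambda>k. Omega_Sch m k M) has_real_derivative D) (at h within {k. (k, M) \<in> S_b m})
          \<and> D < - c) \<and>
     (\<forall>R w l. R \<ge> R_star m \<longrightarrow> 0 < l \<longrightarrow> l = M \<longrightarrow> H0 m R w l = h \<longrightarrow>
        (\<exists>D. ((\<lambda>x. Omega_Sch m (H0 m R w x) x) has_real_derivative D) (at l) \<and> D < - c))}"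

definition S_0 :: "real \<Rightarrow> (real \<times> real) set" where
  "S_0 m = (\<Union>c\<in>{0<..}. S_c m c)"

end

theory Submission
  imports Defs
begin

text \<open>In the variable \<open>v = 2 m / r\<close> with \<open>r = A\<^sub>0 R\<close> the area radius, and with \<open>L = M / (4 m\<^sup>2)\<close>,
  the potential is the cubic \<open>U L v = (1 - v) (1 + L v\<^sup>2)\<close>. Let \<open>a < b < c = 1 - a - b\<close> be the roots of
  \<open>U L v = h\<^sup>2\<close> and \<open>E = 1 - h\<^sup>2 = L a b c\<close>. Writing \<open>v = p + q cos x\<close> between \<open>a\<close> and \<open>b\<close>, the integral
  defining \<open>pi / Omega\<close> becomes \<open>2 m h\<close> times
  \<open>pi E\<^bsup>-1/2\<^esup> (1 / (2 E) + 1) + L\<^bsup>-1/2\<^esup> K(p, q)\<close>: the Keplerian first term carries the whole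
  blow-up as \<open>E \<rightarrow> 0\<close> and does not depend on \<open>L\<close>, while \<open>K\<close> is the integral of a smooth bounded kernel.
  Along every direction in which the two derivatives of the statement are taken, \<open>E\<close> decreases at a
  definite rate, and as long as \<open>b \<le> 0.17\<close> the growth of the first term beats crude bounds on the
  derivatives of \<open>K\<close>. For suitable \<open>M0\<close> and \<open>\<delta>\<close>, both
  regimes of the statement lie in that region.\<close>

subsection \<open>The bounded kernel\<close>

text \<open>The integrand is singular at two moving endpoints, so it cannot be differentiated under
  the integral sign as it stands. With \<open>v = p + q cos x\<close> the Jacobian supplies
  \<open>q sin x = sqrt ((v - a) * (b - v))\<close>, which cancels the vanishing factors and leaves
  the fixed interval \<open>{0..pi}\<close>. The remaining obstacle sits at the circular orbits,
  where \<open>q\<close> tends to 0 and \<open>q'\<close> grows like \<open>1 / q\<close>. An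
  integration by parts gives the \<open>q\<close>-derivative of \<open>K\<close> a factor
  \<open>q\<close>, so that only \<open>q * q'\<close> occurs, and Vieta's relations express
  \<open>p'\<close> and \<open>q * q'\<close> through the rates of \<open>L\<close> and
  \<open>h^2\<close>. Both derivatives of the statement are taken along curves on which the rates
  \<open>l\<close> of \<open>L\<close> and \<open>e\<close> of \<open>h^2\<close> satisfy
  \<open>l * ((1 - a) * a^2) \<le> e\<close>. It suffices that the period does not decrease there:
  Omega is \<open>pi / (2 * m * h * period)\<close>, and the growth of \<open>h\<close> makes its
  decrease strict. The number 0.17 is chosen slightly above \<open>1 / 6\<close>, which bounds the
  minimum point of \<open>U L\<close> for \<open>L > 4\<close>.\<close>

definition rsq :: "real \<Rightarrow> real" where "rsq x = 1 / sqrt x"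

text \<open>Rationalised form of \<open>(sqrt (1 - 2 * p) - sqrt (1 - 2 * p - v)) / v\<close>,
  regular at \<open>v = 0\<close>.\<close>

definition tau :: "real \<Rightarrow> real \<Rightarrow> real" where
  "tau p v = 1 / (sqrt (1 - 2 * p) + sqrt (1 - 2 * p - v))"

text \<open>\<open>kpoly\<close> is what remains of \<open>1 / (v\<^sup>2 (1 - v) sqrt (1 - 2 p - v))\<close> after its polar part at \<open>v = 0\<close>
  is subtracted, see \<open>kernel_identity\<close>; the removable singularity is cancelled by hand.
  \<open>kpoly_p\<close> and \<open>kpoly_v\<close> are the partial derivatives in \<open>p\<close> and \<open>v\<close> of \<open>kpoly\<close> with
  \<open>g = (1 - 2 p)\<^bsup>-1/2\<^esup>\<close>, \<open>d = (1 - 2 p - v)\<^bsup>-1/2\<^esup>\<close>, \<open>t = tau p v\<close>, \<open>w = (1 - v)\<^bsup>-1\<^esup>\<close> substituted.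
  In these variables all of them are polynomials with nonnegative coefficients, so bounds are
  obtained by inserting the largest values.\<close>

definition kpoly :: "real \<Rightarrow> real \<Rightarrow> real \<Rightarrow> real \<Rightarrow> real \<Rightarrow> real" where
  "kpoly g d t w v = g^3 / 2 + (1 + v) / 2 * (g^3 * d * t + g^2 * d * t^2) + w * d"

definition kpoly_p :: "real \<Rightarrow> real \<Rightarrow> real \<Rightarrow> real \<Rightarrow> real \<Rightarrow> real" where
  "kpoly_p g d t w v = 3 * g^5 / 2
     + (1 + v) / 2 * (3 * g^5 * d * t + g^3 * (d^3 * t + d * t^2 * (g + d))
        + 2 * g^4 * d * t^2 + g^2 * (d^3 * t^2 + 2 * d * t^3 * (g + d))) + w * d^3"

definition kpoly_v :: "real \<Rightarrow> real \<Rightarrow> real \<Rightarrow> real \<Rightarrow> real \<Rightarrow> real" where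
  "kpoly_v g d t w v = (g^3 * d * t + g^2 * d * t^2) / 2
     + (1 + v) / 2 * (g^3 * (d^3 * t / 2 + d^2 * t^2 / 2) + g^2 * (d^3 * t^2 / 2 + d^2 * t^3))
     + w^2 * d + w * d^3 / 2"

definition kpoly_vv :: "real \<Rightarrow> real \<Rightarrow> real \<Rightarrow> real \<Rightarrow> real \<Rightarrow> real" where
  "kpoly_vv g d t w v = g^3 * (d^3 * t / 2 + d^2 * t^2 / 2) + g^2 * (d^3 * t^2 / 2 + d^2 * t^3)
     + (1 + v) / 2 * (g^3 * (3 / 4 * d^5 * t + 3 / 4 * d^4 * t^2 + d^3 * t^3 / 2)
        + g^2 * (3 / 4 * d^5 * t^2 + 3 / 2 * d^4 * t^3 + 3 / 2 * d^3 * t^4))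
     + 2 * w^3 * d + w^2 * d^3 + 3 / 4 * w * d^5"

lemmas kpoly_defs = kpoly_def kpoly_p_def kpoly_v_def kpoly_vv_def

definition at_kernel ::
  "(real \<Rightarrow> real \<Rightarrow> real \<Rightarrow> real \<Rightarrow> real \<Rightarrow> real) \<Rightarrow> real \<Rightarrow> real \<Rightarrow> real" where
  "at_kernel F p v = F (rsq (1 - 2 * p)) (rsq (1 - 2 * p - v)) (tau p v) (1 / (1 - v)) v"

lemma rsq_has_derivative:
  fixes f :: "'a::real_normed_vector \<Rightarrow> real"
  assumes "(f has_derivative f') (at x within S)" and "f x > 0"
  shows "((\<lambda>x. rsq (f x)) has_derivative (\<lambda>h. - (rsq (f x)^3 / 2 * f' h))) (at x within S)"
proof -
  have s: "sqrt (f x) ^ 2 = f x" "sqrt (f x) > 0" using assms(2) by auto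
  have "(rsq has_real_derivative - (rsq (f x)^3 / 2)) (at (f x))"
    unfolding rsq_def
    apply (rule derivative_eq_intros refl | use assms(2) in force)+
    using s by (simp add: field_simps power3_eq_cube power2_eq_square)
  then have "(rsq has_derivative (*) (- (rsq (f x)^3 / 2))) (at (f x))"
    by (simp add: has_field_derivative_def)
  from has_derivative_compose[OF assms(1) this] show ?thesis
    by (simp add: mult_ac)
qed

lemma tau_has_derivative:
  fixes p v :: "'a::real_normed_vector \<Rightarrow> real"
  assumes p: "(p has_derivative p') (at x within S)" and v: "(v has_derivative v') (at x within S)"
    and "1 - 2 * p x > 0" and "1 - 2 * p x - v x > 0"
  shows "((\<lambda>x. tau (p x) (v x)) has_derivative
     (\<lambda>h. tau (p x) (v x) ^ 2 *
        (rsq (1 - 2 * p x) * p' h + rsq (1 - 2 * p x - v x) * (2 * p' h + v' h) / 2))) (at x within S)"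
proof -
  have "sqrt (1 - 2 * p x) > 0" "sqrt (1 - 2 * p x - v x) > 0"
    using assms(3,4) by auto
  then have nz: "sqrt (1 - 2 * p x) + sqrt (1 - 2 * p x - v x) \<noteq> 0" by linarith
  have sq: "((\<lambda>x. sqrt (f x)) has_derivative (\<lambda>h. rsq (f x) / 2 * f' h)) (at x within S)"
    if "(f has_derivative f') (at x within S)" "f x > 0" for f f'
    by (rule has_derivative_eq_rhs[OF has_derivative_real_sqrt[OF that(2,1)]])
      (simp add: fun_eq_iff rsq_def field_simps)
  have 1: "((\<lambda>x. sqrt (1 - 2 * p x) + sqrt (1 - 2 * p x - v x)) has_derivative
     (\<lambda>h. rsq (1 - 2 * p x) / 2 * (- 2 * p' h) + rsq (1 - 2 * p x - v x) / 2 * (- 2 * p' h - v' h)))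
     (at x within S)"
    by (intro has_derivative_add sq) (use assms(3,4) in \<open>auto intro!: derivative_eq_intros p v\<close>)
  show ?thesis
    unfolding tau_def
    by (rule has_derivative_eq_rhs[OF has_derivative_divide'[OF has_derivative_const 1 nz]])
      (simp add: fun_eq_iff power2_eq_square algebra_simps add_divide_distrib diff_divide_distrib)
qed

text \<open>The substituted variables are closed under differentiation:
  \<open>g' = g^3 * p'\<close>, \<open>d' = d^3 / 2 * (2 * p' + v')\<close>,
  \<open>t' = t^2 * (g * p' + d * (2 * p' + v') / 2)\<close> and \<open>w' = w^2 * v'\<close>. Hence
  derivatives of the kernel are again polynomials in them.\<close>

lemma kernel_has_derivative:
  fixes p v :: "'a::real_normed_vector \<Rightarrow> real"
  assumes p: "(p has_derivative p') (at x within S)" and v: "(v has_derivative v') (at x within S)"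
    and "1 - 2 * p x > 0" and "1 - 2 * p x - v x > 0" and "v x < 1"
  shows "((\<lambda>x. at_kernel kpoly (p x) (v x)) has_derivative
     (\<lambda>h. at_kernel kpoly_p (p x) (v x) * p' h + at_kernel kpoly_v (p x) (v x) * v' h)) (at x within S)"
proof -
  have g: "((\<lambda>x. rsq (1 - 2 * p x)) has_derivative (\<lambda>h. rsq (1 - 2 * p x)^3 * p' h)) (at x within S)"
    by (rule has_derivative_eq_rhs[OF rsq_has_derivative]) (use assms(3) in \<open>auto intro!: derivative_eq_intros p\<close>)
  have d: "((\<lambda>x. rsq (1 - 2 * p x - v x)) has_derivative
      (\<lambda>h. rsq (1 - 2 * p x - v x)^3 / 2 * (2 * p' h + v' h))) (at x within S)"
    by (rule has_derivative_eq_rhs[OF rsq_has_derivative])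
      (use assms(4) in \<open>auto intro!: derivative_eq_intros p v simp: fun_eq_iff algebra_simps\<close>)
  have w: "((\<lambda>x. 1 / (1 - v x)) has_derivative (\<lambda>h. (1 / (1 - v x))^2 * v' h)) (at x within S)"
    using assms(5)
    by (auto intro!: derivative_eq_intros v simp: fun_eq_iff field_simps power2_eq_square)
  note t = tau_has_derivative[OF assms(1-4)]
  define G where "G = (\<lambda>x. rsq (1 - 2 * p x))"
  define D where "D = (\<lambda>x. rsq (1 - 2 * p x - v x))"
  define W where "W = (\<lambda>x. 1 / (1 - v x))"
  define T where "T = (\<lambda>x. tau (p x) (v x))"
  have g': "(G has_derivative (\<lambda>h. G x^3 * p' h)) (at x within S)" using g by (simp add: G_def)
  have d': "(D has_derivative (\<lambda>h. D x^3 / 2 * (2 * p' h + v' h))) (at x within S)"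
    using d by (simp add: D_def)
  have w': "(W has_derivative (\<lambda>h. (W x)^2 * v' h)) (at x within S)" using w by (simp add: W_def)
  have t': "(T has_derivative (\<lambda>h. T x ^ 2 * (G x * p' h + D x * (2 * p' h + v' h) / 2))) (at x within S)"
    using t by (simp add: T_def G_def D_def)
  have "((\<lambda>x. kpoly (G x) (D x) (T x) (W x) (v x)) has_derivative
     (\<lambda>h. kpoly_p (G x) (D x) (T x) (W x) (v x) * p' h
        + kpoly_v (G x) (D x) (T x) (W x) (v x) * v' h)) (at x within S)"
    unfolding kpoly_def
    apply (rule has_derivative_eq_rhs)
     apply (rule derivative_intros g' d' w' t' v | simp)+
    by (auto simp: fun_eq_iff kpoly_p_def kpoly_v_def field_simps power_numeral_reduce)
  then show ?thesis
    by (simp add: at_kernel_def G_def D_def T_def W_def)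
qed

lemma kernel_v_has_derivative:
  fixes v :: "real \<Rightarrow> real"
  assumes v: "(v has_real_derivative v') (at x within S)"
    and "1 - 2 * p > 0" and "1 - 2 * p - v x > 0" and "v x < 1"
  shows "((\<lambda>x. at_kernel kpoly_v p (v x)) has_real_derivative
     at_kernel kpoly_vv p (v x) * v') (at x within S)"
proof -
  have v1: "(v has_derivative (\<lambda>h. v' * h)) (at x within S)"
    using v by (simp add: has_field_derivative_def)
  define G where "G = rsq (1 - 2 * p)"
  define D where "D = (\<lambda>x. rsq (1 - 2 * p - v x))"
  define W where "W = (\<lambda>x. 1 / (1 - v x))"
  define T where "T = (\<lambda>x. tau p (v x))"
  have d': "(D has_real_derivative D x^3 / 2 * v') (at x within S)"
    unfolding has_field_derivative_def D_def
    by (rule has_derivative_eq_rhs[OF rsq_has_derivative])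
      (use assms(2,3) in \<open>auto intro!: derivative_eq_intros v1 simp: fun_eq_iff algebra_simps\<close>)
  have w': "(W has_real_derivative (W x)^2 * v') (at x within S)"
    unfolding W_def using assms(4)
    by (auto intro!: derivative_eq_intros v simp: fun_eq_iff field_simps power2_eq_square)
  have t': "(T has_real_derivative (T x)^2 * (D x / 2) * v') (at x within S)"
    unfolding has_field_derivative_def D_def T_def
    by (rule has_derivative_eq_rhs[OF tau_has_derivative[where p = "\<lambda>_. p" and p' = "\<lambda>_. 0"]])
      (use assms(2,3) in \<open>auto intro!: derivative_eq_intros v1 simp: fun_eq_iff algebra_simps\<close>)
  have "((\<lambda>x. kpoly_v G (D x) (T x) (W x) (v x)) has_real_derivative
     kpoly_vv G (D x) (T x) (W x) (v x) * v') (at x within S)"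
    unfolding kpoly_v_def
    apply (rule DERIV_cong)
     apply (rule derivative_intros d' w' t' v | simp)+
    by (simp add: kpoly_vv_def field_simps power_numeral_reduce)
  then show ?thesis
    by (simp add: at_kernel_def G_def D_def T_def W_def)
qed

text \<open>The ranges come from \<open>0 < a < b \<le> 0.17\<close>: there
  \<open>1 - 2 * p \<ge> 0.66\<close> and \<open>1 - 2 * p - v \<ge> 0.49\<close>, with roots at
  least 0.81 and 0.7, and the reciprocals of 0.81, 0.7, 1.51 and 0.83 are rounded up. The sum of
  \<open>kpoly_p\<close> and \<open>kpoly_v\<close> is bounded because \<open>orb\<close> also moves
  with \<open>p\<close>.\<close>

lemma kpoly_bounds:
  assumes "0 \<le> g" "g \<le> 1.24" "0 \<le> d" "d \<le> 1.43" "0 \<le> t" "t \<le> 0.67" "0 \<le> w" "w \<le> 1.21" "0 \<le> v" "v \<le> 0.17"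
  shows "0 \<le> kpoly g d t w v" "kpoly g d t w v \<le> 5"
    and "0 \<le> kpoly_p g d t w v + kpoly_v g d t w v" "kpoly_p g d t w v + kpoly_v g d t w v \<le> 32"
    and "0 \<le> kpoly_vv g d t w v" "kpoly_vv g d t w v \<le> 32"
proof -
  show "0 \<le> kpoly g d t w v" "0 \<le> kpoly_p g d t w v + kpoly_v g d t w v" "0 \<le> kpoly_vv g d t w v"
    using assms unfolding kpoly_defs by (auto intro!: add_nonneg_nonneg mult_nonneg_nonneg)
  have "kpoly g d t w v \<le> kpoly 1.24 1.43 0.67 1.21 0.17"
    unfolding kpoly_defs
    by (intro add_mono mult_mono power_mono divide_right_mono order_refl assms mult_nonneg_nonneg add_nonneg_nonneg divide_nonneg_nonneg) (use assms in auto)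
  also have "\<dots> \<le> 5" by (simp add: kpoly_defs power_numeral_reduce)
  finally show "kpoly g d t w v \<le> 5" .
  have "kpoly_p g d t w v + kpoly_v g d t w v \<le> kpoly_p 1.24 1.43 0.67 1.21 0.17 + kpoly_v 1.24 1.43 0.67 1.21 0.17"
    unfolding kpoly_defs
    by (intro add_mono mult_mono power_mono divide_right_mono order_refl assms mult_nonneg_nonneg add_nonneg_nonneg divide_nonneg_nonneg) (use assms in auto)
  also have "\<dots> \<le> 32" by (simp add: kpoly_defs power_numeral_reduce)
  finally show "kpoly_p g d t w v + kpoly_v g d t w v \<le> 32" .
  have "kpoly_vv g d t w v \<le> kpoly_vv 1.24 1.43 0.67 1.21 0.17"
    unfolding kpoly_defs
    by (intro add_mono mult_mono power_mono divide_right_mono order_refl assms mult_nonneg_nonneg add_nonneg_nonneg divide_nonneg_nonneg) (use assms in auto)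
  also have "\<dots> \<le> 32" by (simp add: kpoly_defs power_numeral_reduce)
  finally show "kpoly_vv g d t w v \<le> 32" .
qed

text \<open>Both factors are expanded at \<open>v = 0\<close> with exact second-order remainders:
  \<open>1 / (1 - v) = 1 + v + v^2 / (1 - v)\<close>, and
  \<open>1 / D = 1 / C + v / (2 * C^3)\<close> plus the remainder found in \<open>k3\<close>. In the
  product, the terms of order 0 and 1 form the polar part, and the rest is \<open>v^2\<close> times
  \<open>kpoly\<close>.\<close>

lemma kernel_identity:
  assumes "v > 0" "v < 1 - 2 * p" "v < 1"
  shows "1 / (v^2 * (1 - v) * sqrt (1 - 2 * p - v)) =
    rsq (1 - 2 * p) / v^2 + (rsq (1 - 2 * p) + rsq (1 - 2 * p)^3 / 2) / v + at_kernel kpoly p v"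
proof -
  define C where "C = sqrt (1 - 2 * p)"
  define D where "D = sqrt (1 - 2 * p - v)"
  have C: "C > 0" and D: "D > 0" using assms by (auto simp: C_def D_def)
  have vCD: "v = C^2 - D^2" using assms by (simp add: C_def D_def)
  define w where "w = 1 / (1 - v)"
  have "w * (1 - v) = 1" using assms(3) by (simp add: w_def)
  then have w: "w * (1 - C^2 + D^2) = 1" by (simp add: vCD algebra_simps)
  have CD: "C^2 - D^2 \<noteq> 0" "C - D \<noteq> 0" using assms vCD by auto
  have k1: "at_kernel kpoly p v = 1 / C^3 / 2
     + (1 + v) / 2 * (1 / (C^3 * D * (C + D)) + 1 / (C^2 * D * (C + D)^2)) + w / D"
    by (simp add: at_kernel_def kpoly_def rsq_def tau_def C_def[symmetric] D_def[symmetric] w_def power_divide)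
  have k2: "1 / (C^3 * D * (C + D)) + 1 / (C^2 * D * (C + D)^2) = (2 * C + D) / (C^3 * D * (C + D)^2)"
  proof -
    have "1 / (C^3 * D * S) + 1 / (C^2 * D * S^2) = (S + C) / (C^3 * D * S^2)" if "S > 0" for S
      using C D that by (simp add: field_simps power2_eq_square power3_eq_cube)
    from this[of "C + D"] show ?thesis using C D by (simp add: algebra_simps)
  qed
  \<comment> \<open>Subtracting the linear Taylor polynomial leaves the factor
    \<open>(C - D)^2\<close>, which is \<open>v^2 / (C + D)^2\<close> because
    \<open>v = (C - D) * (C + D)\<close>.\<close>
  have k3: "(1 / D - 1 / C - v / (2 * C^3)) = v^2 * ((2 * C + D) / (2 * C^3 * D * (C + D)^2))"
  proof -
    have "v^2 = (C - D)^2 * (C + D)^2" unfolding vCD by algebra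
    then have "v^2 * ((2 * C + D) / (2 * C^3 * D * (C + D)^2)) = (C - D)^2 * (2 * C + D) / (2 * C^3 * D)"
      using C D by simp
    also have "\<dots> = 1 / D - 1 / C - v / (2 * C^3)"
      using C D unfolding vCD by (simp add: field_simps power2_eq_square power3_eq_cube)
    finally show ?thesis ..
  qed
  have wv: "w = 1 + v + v^2 * w" "w = 1 + v * w"
    using w vCD by algebra+
  have "v^2 * at_kernel kpoly p v = w / D - (1 + v) / C - v / (2 * C^3)"
  proof -
    have "v^2 * at_kernel kpoly p v = v^2 * (1 / C^3 / 2) + (1 + v) * (v^2 * ((2 * C + D) / (2 * C^3 * D * (C + D)^2))) + v^2 * w / D"
      unfolding k1 k2 by (simp add: algebra_simps)
    also have "\<dots> = v^2 / (2 * C^3) + (1 + v) * (1 / D - 1 / C - v / (2 * C^3)) + v^2 * w / D"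
      unfolding k3 by simp
    also have "\<dots> = (1 + v + v^2 * w) / D - (1 + v) / C - v / (2 * C^3)"
      by (simp add: algebra_simps power2_eq_square add_divide_distrib diff_divide_distrib)
    finally show ?thesis using wv by simp
  qed
  then have "at_kernel kpoly p v = (w / D - (1 + v) / C - v / (2 * C^3)) / v^2"
    using assms(1) by (simp add: field_simps)
  moreover have "w / D / v^2 = X / v^2 + (X + Y / 2) / v + (w / D - (1 + v) * X - v * Y / 2) / v^2" for X Y
    using assms(1) by (simp add: field_simps power2_eq_square)
  from this[of "1 / C" "1 / C^3"]
  have "w / D / v^2 = 1 / C / v^2 + (1 / C + 1 / C^3 / 2) / v + (w / D - (1 + v) / C - v / (2 * C^3)) / v^2"
    by simp
  moreover have "1 / (v^2 * (1 - v) * D) = w / D / v^2" by (simp add: w_def)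
  ultimately show ?thesis
    by (simp add: rsq_def C_def[symmetric] D_def[symmetric] power_divide)
qed

subsection \<open>Leibniz rule for the kernel integral\<close>

lemma kpoly_continuous:
  fixes p v :: "'a::topological_space \<Rightarrow> real"
  assumes "continuous_on S p" "continuous_on S v"
    and "\<And>x. x \<in> S \<Longrightarrow> 1 - 2 * p x > (0::real)" "\<And>x. x \<in> S \<Longrightarrow> 1 - 2 * p x - v x > 0" "\<And>x. x \<in> S \<Longrightarrow> v x < 1"
  shows "continuous_on S (\<lambda>x. at_kernel kpoly (p x) (v x))"
    and "continuous_on S (\<lambda>x. at_kernel kpoly_p (p x) (v x))"
    and "continuous_on S (\<lambda>x. at_kernel kpoly_v (p x) (v x))"
    and "continuous_on S (\<lambda>x. at_kernel kpoly_vv (p x) (v x))"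
proof -
  have g: "continuous_on S (\<lambda>x. rsq (1 - 2 * p x))"
    unfolding rsq_def using assms(3) by (intro continuous_intros assms) force
  have d: "continuous_on S (\<lambda>x. rsq (1 - 2 * p x - v x))"
    unfolding rsq_def using assms(4) by (intro continuous_intros assms) force
  have "sqrt (1 - 2 * p x) + sqrt (1 - 2 * p x - v x) \<noteq> 0" if "x \<in> S" for x
  proof -
    have "sqrt (1 - 2 * p x) > 0" "sqrt (1 - 2 * p x - v x) > 0"
      using assms(3,4)[OF that] by auto
    then show ?thesis by linarith
  qed
  then have t: "continuous_on S (\<lambda>x. tau (p x) (v x))"
    unfolding tau_def by (intro continuous_intros assms) auto
  have w: "continuous_on S (\<lambda>x. 1 / (1 - v x))"
    using assms(5) by (intro continuous_intros assms) force
  have k: "continuous_on S (\<lambda>x. kpoly (g x) (d x) (t x) (w x) (v x))"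
    "continuous_on S (\<lambda>x. kpoly_p (g x) (d x) (t x) (w x) (v x))"
    "continuous_on S (\<lambda>x. kpoly_v (g x) (d x) (t x) (w x) (v x))"
    "continuous_on S (\<lambda>x. kpoly_vv (g x) (d x) (t x) (w x) (v x))"
    if "continuous_on S g" "continuous_on S d" "continuous_on S t" "continuous_on S w" "continuous_on S v"
    for g d t w v :: "'a \<Rightarrow> real"
    unfolding kpoly_defs using that by (auto intro!: continuous_intros)
  show "continuous_on S (\<lambda>x. at_kernel kpoly (p x) (v x))"
    "continuous_on S (\<lambda>x. at_kernel kpoly_p (p x) (v x))"
    "continuous_on S (\<lambda>x. at_kernel kpoly_v (p x) (v x))"
    "continuous_on S (\<lambda>x. at_kernel kpoly_vv (p x) (v x))"
    unfolding at_kernel_def by (intro k g d t w assms(2))+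
qed

text \<open>For \<open>z = (p, q)\<close> this says that \<open>p > 0\<close> and that the largest
  value of \<open>orb z\<close> stays below the third root \<open>1 - 2 * p\<close>. The sign of
  \<open>q\<close> is free and the orbit may cross \<open>v = 0\<close>, where the kernel is
  regular; this keeps the set open and convex, as the Leibniz rule requires.\<close>

definition adm :: "(real \<times> real) set" where
  "adm = {z. 0 < fst z \<and> 3 * fst z + snd z < 1 \<and> 3 * fst z - snd z < 1}"

text \<open>Darwin's parametrisation of a Schwarzschild orbit by a relativistic anomaly
  \<open>x\<close>: the reciprocal radius follows a Kepler conic, with pericentre at
  \<open>x = 0\<close> when \<open>q > 0\<close>.\<close>

definition orb :: "real \<times> real \<Rightarrow> real \<Rightarrow> real" where
  "orb z x = fst z + snd z * cos x"

definition kint :: "(real \<Rightarrow> real \<Rightarrow> real \<Rightarrow> real \<Rightarrow> real \<Rightarrow> real) \<Rightarrow> real \<times> real \<Rightarrow> real" where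
  "kint F z = integral {0..pi} (\<lambda>x. at_kernel F (fst z) (orb z x))"

lemma adm_open: "open adm"
proof -
  have "adm = {z. 0 < fst z} \<inter> {z. 3 * fst z + snd z < 1} \<inter> {z. 3 * fst z - snd z < 1}"
    by (auto simp: adm_def)
  also have "open \<dots>"
    by (intro open_Int open_Collect_less continuous_intros)
  finally show ?thesis .
qed

lemma adm_convex: "convex adm"
proof -
  have c: "convex {z :: real \<times> real. f z < k}" if "linear f" for f and k :: real
    using convex_linear_vimage[OF that, of "{..<k}"] by (simp add: vimage_def)
  have l: "linear (\<lambda>z::real\<times>real. - fst z)" "linear (\<lambda>z::real\<times>real. 3 * fst z + snd z)"
    "linear (\<lambda>z::real\<times>real. 3 * fst z - snd z)"
    by (auto intro!: linearI simp: algebra_simps)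
  have "adm = {z. - fst z < 0} \<inter> {z. 3 * fst z + snd z < 1} \<inter> {z. 3 * fst z - snd z < 1}"
    by (auto simp: adm_def)
  also have "convex \<dots>"
    by (intro convex_Int c l)
  finally show ?thesis .
qed

lemma adm_orb:
  assumes "z \<in> adm"
  shows "1 - 2 * fst z > 0" "1 - 2 * fst z - orb z x > 0" "orb z x < 1"
proof -
  have "\<bar>snd z * cos x\<bar> \<le> \<bar>snd z\<bar>"
    by (simp add: abs_mult mult_left_le)
  moreover have "0 < fst z" "3 * fst z + \<bar>snd z\<bar> < 1" using assms by (auto simp: adm_def)
  ultimately show "1 - 2 * fst z > 0" "1 - 2 * fst z - orb z x > 0" "orb z x < 1"
    by (auto simp: orb_def)
qed

lemma kernel_orb_continuous:
  assumes "z \<in> adm"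
  shows "continuous_on X (\<lambda>x. at_kernel kpoly (fst z) (orb z x))"
    and "continuous_on X (\<lambda>x. at_kernel kpoly_p (fst z) (orb z x))"
    and "continuous_on X (\<lambda>x. at_kernel kpoly_v (fst z) (orb z x))"
    and "continuous_on X (\<lambda>x. at_kernel kpoly_vv (fst z) (orb z x))"
  using adm_orb[OF assms]
  by (intro kpoly_continuous; auto simp: orb_def intro!: continuous_intros)+

lemma kint_has_derivative:
  assumes z: "z \<in> adm"
  shows "(kint kpoly has_derivative
     (\<lambda>h. integral {0..pi} (\<lambda>x. at_kernel kpoly_p (fst z) (orb z x) + at_kernel kpoly_v (fst z) (orb z x)) * fst h
        + integral {0..pi} (\<lambda>x. cos x * at_kernel kpoly_v (fst z) (orb z x)) * snd h)) (at z)"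
proof -
  define fx :: "real \<times> real \<Rightarrow> real \<Rightarrow> (real \<times> real) \<Rightarrow>\<^sub>L real" where
    "fx = (\<lambda>z x. (at_kernel kpoly_p (fst z) (orb z x) + at_kernel kpoly_v (fst z) (orb z x)) *\<^sub>R fst_blinfun
       + (cos x * at_kernel kpoly_v (fst z) (orb z x)) *\<^sub>R snd_blinfun)"
  have co: "continuous_on (adm \<times> cbox 0 pi) (\<lambda>(z, x). at_kernel kpoly_p (fst z) (orb z x))"
    "continuous_on (adm \<times> cbox 0 pi) (\<lambda>(z, x). at_kernel kpoly_v (fst z) (orb z x))"
    unfolding split_beta using adm_orb
    by (intro kpoly_continuous; auto simp: orb_def intro!: continuous_intros)+
  have "((\<lambda>z. integral (cbox 0 pi) (\<lambda>x. at_kernel kpoly (fst z) (orb z x)))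
     has_derivative blinfun_apply (integral (cbox 0 pi) (fx z))) (at z within adm)"
  proof (rule leibniz_rule[OF _ _ _ z adm_convex])
    fix y :: "real \<times> real" and x :: real assume y: "y \<in> adm"
    show "((\<lambda>z. at_kernel kpoly (fst z) (orb z x)) has_derivative blinfun_apply (fx y x)) (at y within adm)"
      apply (rule has_derivative_eq_rhs)
       apply (rule kernel_has_derivative[where p' = fst and v' = "\<lambda>h. fst h + snd h * cos x"])
           apply (auto intro!: derivative_eq_intros simp: orb_def)[2]
      using adm_orb(1)[OF y] adm_orb(2,3)[OF y, of x]
      by (auto simp: fx_def fun_eq_iff blinfun.add_left blinfun.scaleR_left algebra_simps)
  next
    fix y :: "real \<times> real" assume y: "y \<in> adm"
    show "(\<lambda>x. at_kernel kpoly (fst y) (orb y x)) integrable_on cbox 0 pi"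
      by (intro integrable_continuous kernel_orb_continuous y)
  next
    show "continuous_on (adm \<times> cbox 0 pi) (\<lambda>(z, x). fx z x)"
      using co unfolding fx_def split_beta by (intro continuous_intros) auto
  qed
  then have D: "(kint kpoly has_derivative blinfun_apply (integral (cbox 0 pi) (fx z))) (at z)"
    unfolding kint_def[abs_def] at_within_open[OF z adm_open] interval_cbox .
  have E: "blinfun_apply (integral (cbox 0 pi) (fx z)) h =
     integral {0..pi} (\<lambda>x. at_kernel kpoly_p (fst z) (orb z x) + at_kernel kpoly_v (fst z) (orb z x)) * fst h
        + integral {0..pi} (\<lambda>x. cos x * at_kernel kpoly_v (fst z) (orb z x)) * snd h" for h
  proof -
    have i: "(\<lambda>x. at_kernel kpoly_p (fst z) (orb z x) + at_kernel kpoly_v (fst z) (orb z x)) integrable_on {0..pi}"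
      "(\<lambda>x. cos x * at_kernel kpoly_v (fst z) (orb z x)) integrable_on {0..pi}"
      by (intro integrable_continuous_interval continuous_intros kernel_orb_continuous z)+
    have c: "continuous_on (cbox 0 pi) (fx z)"
      unfolding fx_def by (intro continuous_intros kernel_orb_continuous z)
    have "blinfun_apply (integral (cbox 0 pi) (fx z)) h = integral (cbox 0 pi) (\<lambda>x. blinfun_apply (fx z x) h)"
      using blinfun_apply_integral[OF integrable_continuous[OF c]] by simp
    also have "\<dots> = integral {0..pi} (\<lambda>x. (at_kernel kpoly_p (fst z) (orb z x) + at_kernel kpoly_v (fst z) (orb z x)) * fst h
       + (cos x * at_kernel kpoly_v (fst z) (orb z x)) * snd h)"
      by (simp add: fx_def blinfun.add_left blinfun.scaleR_left)
    also have "\<dots> = integral {0..pi} (\<lambda>x. (at_kernel kpoly_p (fst z) (orb z x) + at_kernel kpoly_v (fst z) (orb z x)) * fst h)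
       + integral {0..pi} (\<lambda>x. (cos x * at_kernel kpoly_v (fst z) (orb z x)) * snd h)"
      by (intro Henstock_Kurzweil_Integration.integral_add integrable_on_mult_left i)
    finally show ?thesis by simp
  qed
  show ?thesis by (rule has_derivative_eq_rhs[OF D]) (rule ext, rule E)
qed

text \<open>Integration by parts against \<open>sin\<close>, which vanishes at both ends. The gain
  is the factor \<open>snd z\<close>, that is \<open>q\<close>: it pairs with \<open>q'\<close>,
  which is unbounded near circular orbits while \<open>q * q'\<close> is not.\<close>

lemma integral_cos_kernel_v:
  assumes z: "z \<in> adm"
  shows "integral {0..pi} (\<lambda>x. cos x * at_kernel kpoly_v (fst z) (orb z x))
    = snd z * integral {0..pi} (\<lambda>x. (sin x)^2 * at_kernel kpoly_vv (fst z) (orb z x))"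
proof -
  let ?f = "\<lambda>x. cos x * at_kernel kpoly_v (fst z) (orb z x)"
  let ?g = "\<lambda>x. snd z * ((sin x)^2 * at_kernel kpoly_vv (fst z) (orb z x))"
  have "((\<lambda>x. sin x * at_kernel kpoly_v (fst z) (orb z x)) has_real_derivative ?f x - ?g x) (at x within {0..pi})" for x
  proof -
    have o: "(orb z has_real_derivative - snd z * sin x) (at x within {0..pi})"
      unfolding orb_def by (auto intro!: derivative_eq_intros)
    show ?thesis
      by (rule derivative_eq_intros kernel_v_has_derivative[OF o] refl adm_orb z)+
        (simp add: power2_eq_square)
  qed
  then have "((\<lambda>x. ?f x - ?g x) has_integral
     (sin pi * at_kernel kpoly_v (fst z) (orb z pi) - sin 0 * at_kernel kpoly_v (fst z) (orb z 0))) {0..pi}"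
    by (intro fundamental_theorem_of_calculus) (auto simp: has_real_derivative_iff_has_vector_derivative[symmetric])
  then have "integral {0..pi} (\<lambda>x. ?f x - ?g x) = 0" by (simp add: integral_unique)
  moreover have "?f integrable_on {0..pi}" "?g integrable_on {0..pi}"
    by (intro integrable_continuous_interval continuous_intros kernel_orb_continuous z)+
  ultimately have "integral {0..pi} ?f = integral {0..pi} ?g"
    using Henstock_Kurzweil_Integration.integral_diff[of ?f "{0..pi}" ?g] by simp
  then show ?thesis by simp
qed

lemma orb_bounds:
  assumes "0 < a" "a < b" "b \<le> 0.17" and z: "z = ((a + b) / 2, (b - a) / 2)"
  shows "z \<in> adm" "a \<le> orb z x" "orb z x \<le> b"
proof -
  show "z \<in> adm" using assms by (simp add: adm_def field_simps)
  have "\<bar>(b - a) / 2 * cos x\<bar> \<le> \<bar>(b - a) / 2\<bar>"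
    unfolding abs_mult by (rule mult_left_le) auto
  then show "a \<le> orb z x" "orb z x \<le> b" using assms by (auto simp: orb_def z abs_le_iff field_simps)
qed

lemma kernel_bounds:
  assumes ab: "0 < a" "a < b" "b \<le> 0.17" and z: "z = ((a + b) / 2, (b - a) / 2)"
  shows "at_kernel kpoly (fst z) (orb z x) \<in> {0..5}"
    "at_kernel kpoly_p (fst z) (orb z x) + at_kernel kpoly_v (fst z) (orb z x) \<in> {0..32}"
    "at_kernel kpoly_vv (fst z) (orb z x) \<in> {0..32}"
proof -
  define v where "v = orb z x"
  have v: "0 < v" "v \<le> 0.17" using orb_bounds(2,3)[OF ab z, of x] ab by (auto simp: v_def)
  have f: "1 - 2 * fst z \<ge> 0.66" "1 - 2 * fst z - v \<ge> 0.49"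
    using ab z v by (auto simp: field_simps)
  have s: "sqrt (1 - 2 * fst z) \<ge> 0.81" "sqrt (1 - 2 * fst z - v) \<ge> 0.7"
    by (rule real_le_rsqrt, use f in \<open>simp add: power2_eq_square\<close>)+
  have r: "0 \<le> 1 / y \<and> 1 / y \<le> k" if "y \<ge> k'" "k' > 0" "1 / k' \<le> k" for y k k' :: real
    using that frac_le[of 1 1 k' y] by auto
  have b1: "0 \<le> rsq (1 - 2 * fst z) \<and> rsq (1 - 2 * fst z) \<le> 1.24"
    unfolding rsq_def by (rule r[OF s(1)]) simp_all
  have b2: "0 \<le> rsq (1 - 2 * fst z - v) \<and> rsq (1 - 2 * fst z - v) \<le> 1.43"
    unfolding rsq_def by (rule r[OF s(2)]) simp_all
  have b3: "0 \<le> tau (fst z) v \<and> tau (fst z) v \<le> 0.67"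
    unfolding tau_def by (rule r[OF add_mono[OF s]]) simp_all
  have b4: "0 \<le> 1 / (1 - v) \<and> 1 / (1 - v) \<le> 1.21"
    by (rule r[where k' = "0.83"]) (use v in simp_all)
  note * = b1[THEN conjunct1] b1[THEN conjunct2] b2[THEN conjunct1] b2[THEN conjunct2]
    b3[THEN conjunct1] b3[THEN conjunct2] b4[THEN conjunct1] b4[THEN conjunct2] less_imp_le[OF v(1)] v(2)
  show "at_kernel kpoly (fst z) (orb z x) \<in> {0..5}"
    "at_kernel kpoly_p (fst z) (orb z x) + at_kernel kpoly_v (fst z) (orb z x) \<in> {0..32}"
    "at_kernel kpoly_vv (fst z) (orb z x) \<in> {0..32}"
    unfolding at_kernel_def v_def[symmetric] atLeastAtMost_iff
    by (intro conjI kpoly_bounds[OF *])+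
qed

lemma integral_between:
  fixes f :: "real \<Rightarrow> real"
  assumes "continuous_on {0..pi} f" "\<And>x. f x \<in> {0..k}"
  shows "integral {0..pi} f \<in> {0..pi * k}"
proof -
  have i: "f integrable_on {0..pi}" using assms(1) by (rule integrable_continuous_interval)
  have "0 \<le> integral {0..pi} f"
    using assms(2) by (intro Henstock_Kurzweil_Integration.integral_nonneg i) auto
  moreover have "integral {0..pi} f \<le> integral {0..pi} (\<lambda>_. k)"
    using assms(2) by (intro integral_le i) auto
  ultimately show ?thesis by simp
qed

subsection \<open>Evaluation of the period integral\<close>

text \<open>The classical Kepler integrals. The function \<open>c\<close> is the cosine of the
  eccentric anomaly, and \<open>arccos (c x) / s\<close> is a primitive for the first. The second
  follows because the derivative of \<open>sin x / (p + q * cos x)\<close> is a linear combination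
  of both integrands and integrates to 0.\<close>

lemma integral_inverse_orb:
  assumes "0 < q" "q < p"
  shows "((\<lambda>x. 1 / (p + q * cos x)) has_integral pi / sqrt (p^2 - q^2)) {0..pi}"
    and "((\<lambda>x. 1 / (p + q * cos x)^2) has_integral pi * p / ((p^2 - q^2) * sqrt (p^2 - q^2))) {0..pi}"
proof -
  define s where "s = sqrt (p^2 - q^2)"
  have pq: "p^2 - q^2 > 0" using assms by (simp add: power_strict_mono)
  have s: "s > 0" "s^2 = p^2 - q^2" using pq by (auto simp: s_def)
  have den: "p + q * cos x > 0" for x
  proof -
    have "\<bar>q * cos x\<bar> \<le> q" using assms by (simp add: abs_mult mult_left_le)
    then show ?thesis using assms by linarith
  qed
  define c where "c x = (q + p * cos x) / (p + q * cos x)" for x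
  have c2: "1 - (c x)^2 = (s * sin x / (p + q * cos x))^2" for x
  proof -
    have X: "(p + q * cos x)^2 - (q + p * cos x)^2 = s^2 * (sin x)^2"
      unfolding s(2) sin_squared_eq by algebra
    have "1 - (c x)^2 = ((p + q * cos x)^2 - (q + p * cos x)^2) / (p + q * cos x)^2"
      using den[of x] by (simp add: c_def power_divide diff_divide_distrib)
    then show ?thesis
      unfolding X by (simp add: power_divide power_mult_distrib)
  qed
  have cb: "-1 \<le> c x \<and> c x \<le> 1" for x
  proof -
    have "0 \<le> 1 - (c x)^2" unfolding c2 by simp
    then show ?thesis using abs_le_square_iff[of "c x" 1] by auto
  qed
  have cs: "-1 < c x \<and> c x < 1" "sqrt (1 - (c x)^2) = s * sin x / (p + q * cos x)" if "x \<in> {0<..<pi}" for x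
  proof -
    have sx: "sin x > 0" using that sin_gt_zero by auto
    then have "0 < 1 - (c x)^2" unfolding c2 using s(1) den[of x] by simp
    then show "-1 < c x \<and> c x < 1" using abs_square_less_1[of "c x"] by auto
    show "sqrt (1 - (c x)^2) = s * sin x / (p + q * cos x)"
      unfolding c2 using s(1) den[of x] sx by simp
  qed
  have aux: "inverse (- (s * S / Y)) * - (s^2 * S / Y^2) = s / Y" if "s > 0" "S > 0" "Y > 0" for s S Y :: real
    using that by (simp add: field_simps power2_eq_square)
  have dc: "(c has_real_derivative - (s^2 * sin x / (p + q * cos x)^2)) (at x)" for x
  proof -
    have "(p * - sin x) * (p + q * cos x) - (q + p * cos x) * (q * - sin x) = - (s^2 * sin x)"
      unfolding s(2) by algebra
    moreover have "(c has_real_derivative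
        ((p * - sin x) * (p + q * cos x) - (q + p * cos x) * (q * - sin x)) / (p + q * cos x)^2) (at x)"
      unfolding c_def using den[of x] by (auto intro!: derivative_eq_intros simp: power2_eq_square)
    ultimately show ?thesis by simp
  qed
  have "((\<lambda>x. 1 / (p + q * cos x)) has_integral (arccos (c pi) / s - arccos (c 0) / s)) {0..pi}"
  \<comment> \<open>The values of \<open>c\<close> at the two ends are 1 and -1, where
    \<open>arccos\<close> is continuous but not differentiable.\<close>
  proof (rule fundamental_theorem_of_calculus_interior)
    show "continuous_on {0..pi} (\<lambda>x. arccos (c x) / s)"
      using cb s(1) den unfolding c_def
      by (intro continuous_intros) (auto simp: less_imp_neq[OF den, symmetric])
    fix x assume x: "x \<in> {0<..<pi}"
    have sx: "sin x > 0" using x sin_gt_zero by auto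
    have "((\<lambda>x. arccos (c x)) has_real_derivative
        inverse (- sqrt (1 - (c x)^2)) * - (s^2 * sin x / (p + q * cos x)^2)) (at x)"
      by (rule DERIV_chain2[OF DERIV_arccos dc]) (use cs(1)[OF x] in auto)
    then have "((\<lambda>x. arccos (c x)) has_real_derivative s / (p + q * cos x)) (at x)"
      unfolding cs(2)[OF x] by (rule DERIV_cong) (rule aux[OF s(1) sx den])
    from DERIV_cdivide[OF this, of s] show "((\<lambda>x. arccos (c x) / s) has_vector_derivative 1 / (p + q * cos x)) (at x)"
      using s(1) by (simp add: has_real_derivative_iff_has_vector_derivative)
  qed simp
  moreover have "c 0 = 1" "c pi = -1" using assms by (auto simp: c_def field_simps)
  ultimately show I1: "((\<lambda>x. 1 / (p + q * cos x)) has_integral pi / sqrt (p^2 - q^2)) {0..pi}"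
    by (simp add: s_def)
  have "((\<lambda>x. p / q * (1 / (p + q * cos x)) - s^2 / q * (1 / (p + q * cos x)^2)) has_integral
      (sin pi / (p + q * cos pi) - sin 0 / (p + q * cos 0))) {0..pi}"
  proof (rule fundamental_theorem_of_calculus)
    fix x
    have D: "(cos x * (p + q * cos x) - sin x * (q * (- sin x))) / (p + q * cos x)^2
        = p / q * (1 / (p + q * cos x)) - s^2 / q * (1 / (p + q * cos x)^2)"
    proof -
      have N: "N / Y^2 = p / q * (1 / Y) - s^2 / q * (1 / Y^2)" if "q * N = p * Y - s^2" "Y > 0" for N Y
      proof -
        have "N = (p * Y - s^2) / q" using that assms by (simp add: field_simps)
        then show ?thesis
          using that(2) by (simp add: power2_eq_square diff_divide_distrib field_simps)
      qed
      have "q * (cos x * (p + q * cos x) - sin x * (q * (- sin x))) = p * (p + q * cos x) - s^2"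
        using sin_cos_squared_add[of x] unfolding s(2) by algebra
      then show ?thesis using den[of x] by (rule N)
    qed
    have "((\<lambda>x. sin x / (p + q * cos x)) has_real_derivative
        (cos x * (p + q * cos x) - sin x * (q * (- sin x))) / (p + q * cos x)^2) (at x within {0..pi})"
      using den[of x] by (auto intro!: derivative_eq_intros simp: power2_eq_square)
    then show "((\<lambda>x. sin x / (p + q * cos x)) has_vector_derivative
      p / q * (1 / (p + q * cos x)) - s^2 / q * (1 / (p + q * cos x)^2)) (at x within {0..pi})"
      unfolding D by (simp add: has_real_derivative_iff_has_vector_derivative)
  qed simp
  then have "((\<lambda>x. p / q * (1 / (p + q * cos x)) - s^2 / q * (1 / (p + q * cos x)^2)) has_integral 0) {0..pi}"
    by simp
  from has_integral_diff[OF has_integral_mult_right[OF I1, of "p / q"] this]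
  have "((\<lambda>x. s^2 / q * (1 / (p + q * cos x)^2)) has_integral p / q * (pi / s)) {0..pi}"
    by (simp add: s_def)
  from has_integral_mult_right[OF this, of "q / s^2"]
  show "((\<lambda>x. 1 / (p + q * cos x)^2) has_integral pi * p / ((p^2 - q^2) * sqrt (p^2 - q^2))) {0..pi}"
    using s assms by (simp add: s_def mult_ac)
qed

definition period :: "real \<Rightarrow> real \<Rightarrow> real \<times> real \<Rightarrow> real" where
  "period E L z = pi / sqrt E * (1 / (2 * E) + 1) + kint kpoly z / sqrt L"

text \<open>The polar terms of \<open>kernel_identity\<close> integrate in closed form. They depend
  on the roots through \<open>E\<close> alone thanks to Vieta: with \<open>a + b = 2 * p\<close>,
  the relation \<open>L * (a * b + c * (a + b)) = 1\<close> turns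
  \<open>p / (a * b) + 1 / (2 * c)\<close> into \<open>1 / (2 * E)\<close>, and their common
  prefactor is \<open>pi / sqrt E\<close>.\<close>

lemma period_eq:
  assumes ab: "0 < a" "a < b" and c: "c = 1 - a - b" "b < c" and L: "L > 0" "L * (a * b + c * (a + b)) = 1"
    and E: "E = L * (a * b * c)" and z: "z = ((a + b) / 2, (b - a) / 2)"
  shows "((\<lambda>x. 1 / ((orb z x)^2 * (1 - orb z x) * sqrt (L * (c - orb z x)))) has_integral period E L z) {0..pi}"
proof -
  have adm: "z \<in> adm" using ab c by (simp add: z adm_def field_simps)
  define p where "p = (a + b) / 2"
  define q where "q = (b - a) / 2"
  have pq: "0 < q" "q < p" "p^2 - q^2 = a * b" "1 - 2 * p = c"
    using ab c by (auto simp: p_def q_def power2_eq_square field_simps)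
  have orb: "orb z x = p + q * cos x" for x by (simp add: orb_def z p_def q_def)
  have fst_z: "fst z = p" by (simp add: z p_def)
  have orb_pos: "orb z x > 0" for x
  proof -
    have "\<bar>q * cos x\<bar> \<le> q" using pq by (simp add: abs_mult mult_left_le)
    then show ?thesis using pq orb by (smt (verit))
  qed
  define g where "g = rsq c"
  have k: "(\<lambda>x. at_kernel kpoly p (orb z x)) integrable_on {0..pi}"
    using kernel_orb_continuous(1)[OF adm] by (intro integrable_continuous_interval) (simp add: z p_def)
  have "((\<lambda>x. g * (1 / (p + q * cos x)^2) + (g + g^3 / 2) * (1 / (p + q * cos x)) + at_kernel kpoly p (orb z x)) has_integral
     g * (pi * p / ((a * b) * sqrt (a * b))) + (g + g^3 / 2) * (pi / sqrt (a * b)) + kint kpoly z) {0..pi}"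
  proof (intro has_integral_add has_integral_mult_right)
    show "((\<lambda>x. at_kernel kpoly p (orb z x)) has_integral kint kpoly z) {0..pi}"
      using integrable_integral[OF k] by (simp add: kint_def z p_def)
  qed (use integral_inverse_orb[OF pq(1,2)] pq(3) in auto)
  moreover have "g * (1 / (p + q * cos x)^2) + (g + g^3 / 2) * (1 / (p + q * cos x)) + at_kernel kpoly p (orb z x)
     = 1 / ((orb z x)^2 * (1 - orb z x) * sqrt (c - orb z x))" for x
    using kernel_identity[OF orb_pos, of x p] adm_orb(2,3)[OF adm, of x]
    by (simp add: g_def pq(4) orb[symmetric] fst_z)
  ultimately have "((\<lambda>x. 1 / ((orb z x)^2 * (1 - orb z x) * sqrt (c - orb z x))) has_integral
     g * (pi * p / ((a * b) * sqrt (a * b))) + (g + g^3 / 2) * (pi / sqrt (a * b)) + kint kpoly z) {0..pi}"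
    by simp
  from has_integral_mult_right[OF this, of "1 / sqrt L"]
  have "((\<lambda>x. 1 / ((orb z x)^2 * (1 - orb z x) * sqrt (L * (c - orb z x)))) has_integral
     1 / sqrt L * (g * (pi * p / ((a * b) * sqrt (a * b))) + (g + g^3 / 2) * (pi / sqrt (a * b)) + kint kpoly z)) {0..pi}"
    by (simp add: real_sqrt_mult mult_ac)
  moreover have "1 / sqrt L * (g * (pi * p / ((a * b) * sqrt (a * b))) + (g + g^3 / 2) * (pi / sqrt (a * b)) + kint kpoly z)
    = period E L z"
  proof -
    have c0: "c > 0" using ab c by simp
    have sE: "sqrt E = sqrt L * sqrt (a * b) * sqrt c" by (simp add: E real_sqrt_mult)
    have g3: "g^3 = g / c" using c0 by (simp add: g_def rsq_def power3_eq_cube field_simps)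
    have e: "p / (a * b) + 1 / (2 * c) = 1 / (2 * E)"
    proof -
      have "2 * p * c + a * b = 1 / L" using L by (simp add: p_def field_simps)
      moreover have "p / (a * b) + 1 / (2 * c) = (2 * p * c + a * b) / (2 * (a * b * c))"
        using ab c0 by (simp add: field_simps)
      ultimately show ?thesis by (simp add: E)
    qed
    have "1 / sqrt L * (g * (pi * p / ((a * b) * sqrt (a * b))) + (g + g^3 / 2) * (pi / sqrt (a * b)) + kint kpoly z)
       = pi * (1 / sqrt L * g / sqrt (a * b)) * (p / (a * b) + 1 / (2 * c) + 1) + kint kpoly z / sqrt L"
      unfolding g3 using ab c0 L(1) by (simp add: field_simps)
    also have "1 / sqrt L * g / sqrt (a * b) = 1 / sqrt E"
      unfolding sE g_def rsq_def by simp
    finally show ?thesis unfolding e period_def by simp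
  qed
  ultimately show ?thesis by simp
qed

subsection \<open>Turning points in the variable v\<close>

text \<open>Inverse of \<open>v = 2 m / r\<close> in terms of \<open>R\<close>: the lapse
  \<open>alpha0 m R = sqrt (1 - v)\<close> is a linear fractional function of \<open>R\<close> and
  is solved for it.\<close>

definition Rv :: "real \<Rightarrow> real \<Rightarrow> real" where
  "Rv m v = m / 2 * ((1 + sqrt (1 - v)) / (1 - sqrt (1 - v)))"

definition U :: "real \<Rightarrow> real \<Rightarrow> real" where
  "U L v = (1 - v) * (1 + L * v^2)"

lemma sqrt_lapse:
  assumes "0 < v" "v < (1::real)"
  shows "0 < sqrt (1 - v)" "sqrt (1 - v) < 1" "(sqrt (1 - v))^2 = 1 - v"
  using assms by auto

lemma alpha0_Rv:
  assumes "m > 0" "0 < v" "v < 1"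
  shows "alpha0 m (Rv m v) = sqrt (1 - v)"
proof -
  define b where "b = sqrt (1 - v)"
  have b: "0 < b" "b < 1" using sqrt_lapse[OF assms(2,3)] by (auto simp: b_def)
  have R: "2 * Rv m v = m * (1 + b) / (1 - b)" using b by (simp add: Rv_def b_def[symmetric] field_simps)
  have "2 * Rv m v - m = 2 * m * b / (1 - b)" "2 * Rv m v + m = 2 * m / (1 - b)"
    unfolding R using b by (simp_all add: field_simps)
  then show ?thesis using assms(1) b by (simp add: alpha0_def b_def[symmetric])
qed

lemma A0_Rv:
  assumes "m > 0" "0 < v" "v < 1"
  shows "A0 m (Rv m v) = 4 / (1 + sqrt (1 - v))^2" "A0 m (Rv m v) * Rv m v = 2 * m / v"
proof -
  define b where "b = sqrt (1 - v)"
  have b: "0 < b" "b < 1" and v: "v = (1 - b) * (1 + b)"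
    using sqrt_lapse[OF assms(2,3)] by (auto simp: b_def algebra_simps power2_eq_square)
  have R: "2 * Rv m v = m * (1 + b) / (1 - b)" using b by (simp add: Rv_def b_def[symmetric] field_simps)
  have "m / (2 * Rv m v) = (1 - b) / (1 + b)"
    unfolding R using assms(1) b by simp
  then have "1 + m / (2 * Rv m v) = 2 / (1 + b)" using b by (simp add: field_simps)
  then show A: "A0 m (Rv m v) = 4 / (1 + sqrt (1 - v))^2"
    by (simp add: A0_def b_def[symmetric] power_divide)
  have "A0 m (Rv m v) * Rv m v = 4 / (1 + b)^2 * (m / 2 * ((1 + b) / (1 - b)))"
    unfolding A by (simp add: Rv_def b_def[symmetric])
  also have "\<dots> = 2 * m / v"
  proof -
    have "4 / X^2 * (m / 2 * (X / Y)) = 2 * m / (Y * X)" if "X > 0" "Y > 0" for X Y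
      using that by (simp add: power2_eq_square field_simps)
    from this[of "1 + b" "1 - b"] show ?thesis unfolding v using b by simp
  qed
  finally show "A0 m (Rv m v) * Rv m v = 2 * m / v" .
qed

lemma centrifugal_Rv:
  assumes "m > 0" "0 < v" "v < 1"
  shows "M / ((A0 m (Rv m v))^2 * (Rv m v)^2) = M / (4 * m^2) * v^2"
  unfolding power_mult_distrib[symmetric] A0_Rv(2)[OF assms] by (simp add: power_divide power_mult_distrib)

lemma V0_Rv:
  assumes "m > 0" "0 < v" "v < 1"
  shows "V0 m (Rv m v) M = U (M / (4 * m^2)) v"
  unfolding V0_def centrifugal_Rv[OF assms] alpha0_Rv[OF assms] U_def
  using sqrt_lapse(3)[OF assms(2,3)] by simp

lemma Rv_less:
  assumes "m > 0" "0 < x" "x < y" "y < 1"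
  shows "Rv m y < Rv m x"
proof -
  have s: "sqrt (1 - y) < sqrt (1 - x)" "0 < sqrt (1 - y)" "sqrt (1 - x) < 1" using assms by auto
  then have "(1 + sqrt (1 - y)) / (1 - sqrt (1 - y)) < (1 + sqrt (1 - x)) / (1 - sqrt (1 - x))"
    by (intro frac_less) auto
  then show ?thesis unfolding Rv_def by (rule mult_strict_left_mono) (use assms(1) in simp)
qed

lemma Rv_less_iff:
  assumes "m > 0" "0 < x" "x < 1" "0 < y" "y < 1"
  shows "Rv m y < Rv m x \<longleftrightarrow> x < y"
  using Rv_less[of m x y] Rv_less[of m y x] assms by (cases x y rule: linorder_cases) auto

text \<open>The range \<open>R \<ge> R_star m\<close> is thus \<open>r \<ge> 4 m\<close>, or
  \<open>v \<le> 1 / 2\<close>. In the limiting case \<open>L = 4\<close>, that is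
  \<open>M = 16 * m^2\<close>, the point \<open>v = 1 / 2\<close> is the local maximum of
  \<open>U L\<close>, at height 1: the marginally bound circular orbit.\<close>

lemma Rv_half: "Rv m (1 / 2) = R_star m"
proof -
  have s: "sqrt (1 / 2) = sqrt 2 / 2" by (simp add: real_sqrt_divide real_div_sqrt field_simps)
  have "1 < sqrt (2::real)" by simp
  moreover have "sqrt 2 < (2::real)" using real_sqrt_less_mono[of 2 4] by simp
  ultimately have "(1 + sqrt 2 / 2) / (1 - sqrt 2 / 2) / 2 = 3 / 2 + sqrt (2::real)"
    by (simp add: field_simps)
  then have "m * ((1 + sqrt 2 / 2) / (1 - sqrt 2 / 2) / 2) = m * (3 / 2 + sqrt 2)" by (rule arg_cong)
  then show ?thesis by (simp add: Rv_def R_star_def s mult_ac)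
qed

lemma Rv_surj:
  assumes "m > 0" "R \<ge> R_star m"
  obtains v where "0 < v" "v \<le> 1 / 2" "R = Rv m v"
proof -
  have "1 / 2 < 3 / 2 + sqrt (2::real)" using real_sqrt_gt_zero[of 2] by linarith
  then have "1 / 2 * m < (3 / 2 + sqrt 2) * m" using assms(1) by (rule mult_strict_right_mono)
  then have R: "R > m / 2" "R > 0" using assms unfolding R_star_def by linarith+
  define b where "b = (2 * R - m) / (2 * R + m)"
  have b: "0 < b" "b < 1" using R assms(1) by (auto simp: b_def field_simps)
  define v where "v = 1 - b^2"
  have v: "0 < v" "v < 1" "sqrt (1 - v) = b" using b by (auto simp: v_def power_less_one_iff)
  have Rv: "R = Rv m v"
  proof -
    have "1 + b = 4 * R / (2 * R + m)" "1 - b = 2 * m / (2 * R + m)"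
      using R assms(1) by (auto simp: b_def field_simps)
    then show ?thesis using R assms(1) by (simp add: Rv_def v(3))
  qed
  have "\<not> 1 / 2 < v" using Rv_less[of m "1/2" v] assms v by (auto simp: Rv Rv_half)
  then show ?thesis using that v Rv by auto
qed

lemma Rv_ge_R_star:
  assumes "m > 0" "0 < v" "v \<le> 1 / 2"
  shows "R_star m \<le> Rv m v"
proof (cases "v = 1 / 2")
  case False
  then show ?thesis using Rv_less[of m v "1/2"] assms unfolding Rv_half[symmetric] by simp
qed (simp only: Rv_half order_refl)

text \<open>Smaller zero of the derivative of \<open>U L\<close>. The two zeros add up to
  \<open>2 / 3\<close>, so for \<open>L > 4\<close> the bound \<open>v_min L < 1 / 6\<close> pushes
  the other one beyond \<open>1 / 2\<close>, out of the range. The value \<open>1 / 6\<close>, that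
  is \<open>r = 12 m\<close>, is attained at \<open>L = 4\<close>.\<close>

definition v_min :: "real \<Rightarrow> real" where
  "v_min L = (1 - sqrt (1 - 3 / L)) / 3"

lemma v_min_bounds:
  assumes "L > 4"
  shows "0 < v_min L" "v_min L < 1 / 6" "1 / L = v_min L * (2 - 3 * v_min L)"
proof -
  define s where "s = sqrt (1 - 3 / L)"
  have l: "1 / 4 < 1 - 3 / L" "1 - 3 / L < 1" using assms by (auto simp: field_simps)
  have "1 / 2 < s" unfolding s_def by (rule real_less_rsqrt) (use l in \<open>simp add: power2_eq_square\<close>)
  moreover have "s < 1" unfolding s_def using l(2) real_sqrt_less_mono[of _ 1] by fastforce
  moreover have "s^2 = 1 - 3 / L" unfolding s_def by (rule real_sqrt_pow2) (use l in linarith)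
  ultimately have s: "s > 1 / 2" "s < 1" "s^2 = 1 - 3 / L" by auto
  then show "0 < v_min L" "v_min L < 1 / 6" by (auto simp: v_min_def s_def)
  show "1 / L = v_min L * (2 - 3 * v_min L)"
  proof -
    have "(1 - s) / 3 * (2 - 3 * ((1 - s) / 3)) = (1 - s^2) / 3"
      by (simp add: field_simps power2_eq_square)
    then show ?thesis unfolding v_min_def s_def[symmetric] s(3) by simp
  qed
qed

lemma U_has_derivative:
  "(U L has_real_derivative -1 + 2 * L * v - 3 * L * v^2) (at v)"
  unfolding U_def by (auto intro!: derivative_eq_intros simp: algebra_simps power2_eq_square power3_eq_cube)

lemma U_deriv_factor:
  assumes "L > 4"
  shows "-1 + 2 * L * v - 3 * L * v^2 = 3 * L * (v - v_min L) * (2 / 3 - v_min L - v)"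
proof -
  have "1 = L * (v_min L * (2 - 3 * v_min L))"
    using v_min_bounds(3)[OF assms] assms by (simp add: field_simps)
  then show ?thesis by algebra
qed

lemma U_dec:
  assumes "L > 4" "0 \<le> x" "x < y" "y \<le> v_min L"
  shows "U L y < U L x"
proof -
  note b = v_min_bounds[OF assms(1)]
  have "\<exists>d. (U L has_real_derivative d) (at v) \<and> d < 0" if "x < v" "v < y" for v
  proof -
    have "3 * L * (v - v_min L) * (2 / 3 - v_min L - v) < 0"
      using that assms b by (intro mult_neg_pos mult_pos_neg) auto
    then show ?thesis using U_has_derivative[of L v] unfolding U_deriv_factor[OF assms(1)] by blast
  qed
  moreover have "continuous_on {x..y} (U L)" unfolding U_def by (intro continuous_intros)
  ultimately show ?thesis using DERIV_neg_imp_decreasing_open[OF assms(3)] by blast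
qed

lemma U_inc:
  assumes "L > 4" "v_min L \<le> x" "x < y" "y \<le> 1 / 2"
  shows "U L x < U L y"
proof -
  note b = v_min_bounds[OF assms(1)]
  have "\<exists>d. (U L has_real_derivative d) (at v) \<and> d > 0" if "x < v" "v < y" for v
  proof -
    have "3 * L * (v - v_min L) * (2 / 3 - v_min L - v) > 0"
      using that assms b by (intro mult_pos_pos) auto
    then show ?thesis using U_has_derivative[of L v] unfolding U_deriv_factor[OF assms(1)] by blast
  qed
  moreover have "continuous_on {x..y} (U L)" unfolding U_def by (intro continuous_intros)
  ultimately show ?thesis using DERIV_pos_imp_increasing_open[OF assms(3)] by blast
qed

lemma U_min_le:
  assumes "L > 4" "0 < v" "v \<le> 1 / 2"
  shows "U L (v_min L) \<le> U L v"
  using U_dec[OF assms(1), of v "v_min L"] U_inc[OF assms(1), of "v_min L" v] assms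
  by (cases v "v_min L" rule: linorder_cases) auto

lemma R_min_eq:
  assumes m: "m > 0" and M: "M > 16 * m^2"
  shows "R_min m M = Rv m (v_min (M / (4 * m^2)))"
proof -
  define L where "L = M / (4 * m^2)"
  have L: "L > 4" using m M by (simp add: L_def field_simps)
  note b = v_min_bounds[OF L]
  have V: "V0 m (Rv m v) M = U L v" if "0 < v" "v \<le> 1 / 2" for v
    using V0_Rv[of m v M] m that by (simp add: L_def)
  show ?thesis
    unfolding R_min_def L_def[symmetric]
  proof (rule the_equality, rule conjI)
    show "Rv m (v_min L) \<in> {R_star m..}" using Rv_ge_R_star[OF m] b by simp
    have "V0 m (Rv m (v_min L)) M \<le> V0 m x M" if x: "x \<ge> R_star m" for x
    proof -
      obtain v where v: "0 < v" "v \<le> 1 / 2" "x = Rv m v" using Rv_surj[OF m x] by blast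
      then show ?thesis using U_min_le[OF L v(1,2)] V b by simp
    qed
    then show "\<forall>\<^sub>F x in at (Rv m (v_min L)) within {R_star m..}. V0 m (Rv m (v_min L)) M \<le> V0 m x M"
      by (auto simp: eventually_at intro!: exI[of _ 1])
  next
    fix R assume R: "R \<in> {R_star m..} \<and> (\<forall>\<^sub>F x in at R within {R_star m..}. V0 m R M \<le> V0 m x M)"
    obtain v where v: "0 < v" "v \<le> 1 / 2" "R = Rv m v" using R Rv_surj[OF m, of R] by auto
    obtain d where d: "d > 0" "\<And>x. x \<ge> R_star m \<Longrightarrow> x \<noteq> R \<Longrightarrow> dist x R < d \<Longrightarrow> V0 m R M \<le> V0 m x M"
      using R by (auto simp: eventually_at)
    \<comment> \<open>A point strictly between \<open>R\<close> and the true minimum point, and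
      within \<open>d\<close> of \<open>R\<close>, has strictly smaller potential, since
      \<open>U L\<close> is strictly monotone on either side of \<open>v_min L\<close>. This also
      excludes the end point \<open>R_star m\<close>.\<close>
    have no: False if y: "min (Rv m (v_min L)) R < y" "y < max (Rv m (v_min L)) R" "dist y R < d" for y
    proof -
      have Rs: "R_star m \<le> Rv m (v_min L)" "R_star m \<le> R" using Rv_ge_R_star[OF m] b v by auto
      then have y1: "y \<ge> R_star m" "y \<noteq> R" using y by (auto simp: min_def max_def split: if_splits)
      obtain u where u: "0 < u" "u \<le> 1 / 2" "y = Rv m u" using Rv_surj[OF m y1(1)] by auto
      have "min (v_min L) v < u \<and> u < max (v_min L) v"
        using y(1,2) Rv_less_iff[OF m] u v b by (auto simp: min_def max_def not_le split: if_splits)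
      then have "U L u < U L v"
        using U_dec[OF L, of v u] U_inc[OF L, of u v] u v b by (auto simp: min_def max_def split: if_splits)
      then show False using d(2)[OF y1 y(3)] V u v by simp
    qed
    show "R = Rv m (v_min L)"
    proof (rule ccontr)
      assume ne: "R \<noteq> Rv m (v_min L)"
      show False
      proof (cases "R < Rv m (v_min L)")
        case True
        obtain y where "R < y" "y < min (R + d) (Rv m (v_min L))"
          using dense[of R "min (R + d) (Rv m (v_min L))"] True d(1) by auto
        then show False using True by (intro no[of y]) (auto simp: dist_real_def)
      next
        case False
        then obtain y where "max (R - d) (Rv m (v_min L)) < y" "y < R"
          using dense[of "max (R - d) (Rv m (v_min L))" R] ne d(1) by auto
        then show False using False by (intro no[of y]) (auto simp: dist_real_def)
      qed
    qed
  qed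
qed

lemma V_min_eq:
  assumes "m > 0" "M > 16 * m^2"
  shows "V_min m M = U (M / (4 * m^2)) (v_min (M / (4 * m^2)))"
proof -
  have "M / (4 * m^2) > 4" using assms by (simp add: field_simps)
  note b = v_min_bounds[OF this]
  then show ?thesis using V0_Rv[of m "v_min (M / (4 * m^2))" M] assms
    by (simp add: V_min_def R_min_eq)
qed

text \<open>Since \<open>Rv m\<close> reverses order, the inner turning point belongs to the larger
  root \<open>b\<close>. Strict monotonicity of \<open>U\<close> on either side of its minimum makes
  both definite descriptions unique.\<close>

lemma turning_points:
  assumes m: "m > 0" and M: "M > 16 * m^2" and ab: "0 < a" "a < b" "b < 1 / 2"
    and Ua: "U (M / (4 * m^2)) a = h^2" and Ub: "U (M / (4 * m^2)) b = h^2"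
  shows "R_minus m h M = Rv m b" "R_plus m h M = Rv m a" "V_min m M < h^2"
    and "a < v_min (M / (4 * m^2))" "v_min (M / (4 * m^2)) < b"
proof -
  define L where "L = M / (4 * m^2)"
  have L: "L > 4" using m M by (simp add: L_def field_simps)
  note b = v_min_bounds[OF L]
  note Uab = Ua[folded L_def] Ub[folded L_def]
  have V: "V0 m (Rv m v) M = U L v" if "0 < v" "v \<le> 1 / 2" for v
    using V0_Rv[of m v M] m that by (simp add: L_def)
  have av: "a < v_min L"
    using U_inc[OF L, of a b] Uab ab by (auto simp: not_less[symmetric])
  have bv: "v_min L < b"
    using U_dec[OF L, of a b] Uab ab by (auto simp: not_less[symmetric])
  show "a < v_min (M / (4 * m^2))" "v_min (M / (4 * m^2)) < b" using av bv by (auto simp: L_def)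
  show "V_min m M < h^2"
    using U_inc[OF L, of "v_min L" b] bv ab Uab by (simp add: V_min_eq[OF m M] L_def)
  note lt = Rv_less_iff[OF m]
  show "R_minus m h M = Rv m b"
    unfolding R_minus_def R_min_eq[OF m M] L_def[symmetric]
  proof (rule the_equality)
    show "R_star m < Rv m b \<and> Rv m b < Rv m (v_min L) \<and> V0 m (Rv m b) M = h^2"
      unfolding Rv_half[symmetric] using lt bv b ab Uab V by auto
  next
    fix R assume R: "R_star m < R \<and> R < Rv m (v_min L) \<and> V0 m R M = h^2"
    obtain v where v: "0 < v" "v \<le> 1 / 2" "R = Rv m v" using R Rv_surj[OF m, of R] by auto
    then have "v_min L < v" "U L v = h^2" using R lt[of "v_min L" v] b V by auto
    then have "v = b"
      using U_inc[OF L, of v b] U_inc[OF L, of b v] Uab v ab bv by (cases v b rule: linorder_cases) auto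
    then show "R = Rv m b" using v by simp
  qed
  show "R_plus m h M = Rv m a"
    unfolding R_plus_def R_min_eq[OF m M] L_def[symmetric]
  proof (rule the_equality)
    show "Rv m (v_min L) < Rv m a \<and> V0 m (Rv m a) M = h^2"
      using lt av b ab Uab V by auto
  next
    fix R assume R: "Rv m (v_min L) < R \<and> V0 m R M = h^2"
    then have "R_star m \<le> R" using Rv_ge_R_star[OF m, of "v_min L"] b by auto
    then obtain v where v: "0 < v" "v \<le> 1 / 2" "R = Rv m v" using Rv_surj[OF m, of R] by auto
    then have "v < v_min L" "U L v = h^2" using R lt[of v "v_min L"] b V by auto
    then have "v = a"
      using U_dec[OF L, of v a] U_dec[OF L, of a v] Uab v ab av by (cases v a rule: linorder_cases) auto
    then show "R = Rv m a" using v by simp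
  qed
qed

text \<open>Vieta for \<open>v^3 - v^2 + v / L - (1 - k) / L\<close>: the roots add up to 1, which
  identifies the third as \<open>1 - a - b\<close>, and the other two symmetric functions are
  \<open>1 / L\<close> and \<open>(1 - k) / L\<close>.\<close>

lemma cubic_factor:
  assumes ab: "a \<noteq> b" and Ua: "U L a = k" and Ub: "U L b = k"
  shows "k - U L v = L * (v - a) * (b - v) * (1 - a - b - v)"
    and "L * (a * b + (1 - a - b) * (a + b)) = 1"
    and "1 - k = L * (a * b * (1 - a - b))"
proof -
  have "(a - b) * (L * (a * b + (1 - a - b) * (a + b)) - 1) = U L a - U L b"
    unfolding U_def by algebra
  then show 1: "L * (a * b + (1 - a - b) * (a + b)) = 1" using ab Ua Ub by simp
  have "1 - U L a - L * (a * b * (1 - a - b)) = a * (1 - L * (a * b + (1 - a - b) * (a + b)))"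
    unfolding U_def by algebra
  then show 2: "1 - k = L * (a * b * (1 - a - b))" unfolding 1 Ua by simp
  have "(k - U L v) - L * (v - a) * (b - v) * (1 - a - b - v)
     = v * (1 - L * (a * b + (1 - a - b) * (a + b))) - ((1 - k) - L * (a * b * (1 - a - b)))"
    unfolding U_def by algebra
  then show "k - U L v = L * (v - a) * (b - v) * (1 - a - b - v)" unfolding 1 2 by simp
qed

subsection \<open>Change of variables\<close>

lemma Rv_orb_has_derivative:
  assumes "0 < orb z x" "orb z x < 1"
  defines "\<beta> \<equiv> sqrt (1 - orb z x)"
  shows "((\<lambda>x. Rv m (orb z x)) has_real_derivative m * (snd z * sin x) / (2 * \<beta> * (1 - \<beta>)^2)) (at x within S)"
proof -
  have \<beta>: "0 < \<beta>" "\<beta> < 1" using assms(1,2) by (auto simp: \<beta>_def)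
  have b: "((\<lambda>x. sqrt (1 - orb z x)) has_real_derivative snd z * sin x / (2 * \<beta>)) (at x within S)"
  proof -
    have o: "(orb z has_real_derivative - snd z * sin x) (at x within S)"
      unfolding orb_def by (auto intro!: derivative_eq_intros)
    have "((\<lambda>x. sqrt (1 - orb z x)) has_real_derivative
        inverse (sqrt (1 - orb z x)) / 2 * (0 - - snd z * sin x)) (at x within S)"
      by (rule DERIV_chain2[OF DERIV_real_sqrt DERIV_diff[OF DERIV_const o]]) (use assms(2) in simp)
    then show ?thesis unfolding \<beta>_def[symmetric] by (rule DERIV_cong) (use \<beta> in \<open>simp add: field_simps\<close>)
  qed
  have "((\<lambda>x. (1 + sqrt (1 - orb z x)) / (1 - sqrt (1 - orb z x))) has_real_derivative
      ((0 + snd z * sin x / (2 * \<beta>)) * (1 - \<beta>) - (1 + \<beta>) * (0 - snd z * sin x / (2 * \<beta>))) / ((1 - \<beta>) * (1 - \<beta>))) (at x within S)"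
    unfolding \<beta>_def
    by (intro DERIV_divide DERIV_add DERIV_diff DERIV_const b[unfolded \<beta>_def])
      (use \<beta> in \<open>simp add: \<beta>_def\<close>)
  moreover have "((0 + snd z * sin x / (2 * \<beta>)) * (1 - \<beta>) - (1 + \<beta>) * (0 - snd z * sin x / (2 * \<beta>))) / ((1 - \<beta>) * (1 - \<beta>))
     = 2 * (snd z * sin x / (2 * \<beta>)) / (1 - \<beta>)^2"
  proof -
    have "(0 + t) * (1 - \<beta>) - (1 + \<beta>) * (0 - t) = 2 * t" for t by (simp add: algebra_simps)
    then show ?thesis unfolding power2_eq_square by (rule arg_cong)
  qed
  ultimately have "((\<lambda>x. (1 + sqrt (1 - orb z x)) / (1 - sqrt (1 - orb z x))) has_real_derivative
      2 * (snd z * sin x / (2 * \<beta>)) / (1 - \<beta>)^2) (at x within S)" by simp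
  from DERIV_cmult[OF this, of "m / 2"] show ?thesis
    by (simp add: Rv_def[abs_def] mult_ac)
qed

lemma orb_image:
  assumes "0 < a" "a < b" "b < 1" "m > 0" and z: "z = ((a + b) / 2, (b - a) / 2)"
  shows "(\<lambda>x. Rv m (orb z x)) ` {0<..<pi} = {Rv m b<..<Rv m a}" "inj_on (\<lambda>x. Rv m (orb z x)) {0<..<pi}"
    and "x \<in> {0<..<pi} \<Longrightarrow> a < orb z x \<and> orb z x < b"
proof -
  have lt: "orb z y < orb z x" if "0 \<le> x" "x < y" "y \<le> pi" for x y
    using cos_monotone_0_pi[OF that] assms by (simp add: orb_def z)
  have ends: "orb z 0 = b" "orb z pi = a" by (auto simp: orb_def z field_simps)
  have bd: "a < orb z x \<and> orb z x < b" if "x \<in> {0<..<pi}" for x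
    using lt[of 0 x] lt[of x pi] that ends by auto
  then show "x \<in> {0<..<pi} \<Longrightarrow> a < orb z x \<and> orb z x < b" .
  note Rlt = Rv_less_iff[OF assms(4)]
  have less: "Rv m (orb z x) < Rv m (orb z y)" if "x \<in> {0<..<pi}" "y \<in> {0<..<pi}" "x < y" for x y
  proof (rule Rv_less[OF assms(4)])
    show "0 < orb z y" "orb z x < 1" using bd[OF that(1)] bd[OF that(2)] assms(1-3) by linarith+
    show "orb z y < orb z x" using lt[of x y] that by simp
  qed
  then show "inj_on (\<lambda>x. Rv m (orb z x)) {0<..<pi}"
    by (intro linorder_inj_onI) (auto dest: less_imp_neq)
  show "(\<lambda>x. Rv m (orb z x)) ` {0<..<pi} = {Rv m b<..<Rv m a}"
  proof (intro equalityI subsetI)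
    fix R assume "R \<in> (\<lambda>x. Rv m (orb z x)) ` {0<..<pi}"
    then obtain x where x: "x \<in> {0<..<pi}" "R = Rv m (orb z x)" by auto
    then show "R \<in> {Rv m b<..<Rv m a}"
      using bd[OF x(1)] Rlt[of "orb z x" b] Rlt[of a "orb z x"] assms(1-3) by auto
  next
    fix R assume R: "R \<in> {Rv m b<..<Rv m a}"
    have cont: "continuous_on {0..pi} (\<lambda>x. Rv m (orb z x))"
    proof (rule DERIV_continuous_on)
      fix x assume x: "x \<in> {0..pi}"
      have "a \<le> orb z x" "orb z x \<le> b"
        using lt[of 0 x] lt[of x pi] ends x by (cases "x = 0"; cases "x = pi"; force)+
      then show "((\<lambda>x. Rv m (orb z x)) has_real_derivative
         m * (snd z * sin x) / (2 * sqrt (1 - orb z x) * (1 - sqrt (1 - orb z x))^2)) (at x within {0..pi})"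
        using assms(1,3) by (intro Rv_orb_has_derivative) auto
    qed
    obtain x where x: "0 \<le> x" "x \<le> pi" "Rv m (orb z x) = R"
      using IVT'[of "\<lambda>x. Rv m (orb z x)" 0 R pi] R cont ends by auto
    then have "x \<noteq> 0" "x \<noteq> pi" using R ends by auto
    then show "R \<in> (\<lambda>x. Rv m (orb z x)) ` {0<..<pi}" using x by force
  qed
qed

lemma w_of_Rv:
  assumes "m > 0" "0 < v" "v < 1"
  shows "w_of m (Rv m v) h M = sqrt (h^2 - U (M / (4 * m^2)) v) / sqrt (1 - v)"
proof -
  have "h^2 / (1 - v) - 1 - M / (4 * m^2) * v^2 = (h^2 - U (M / (4 * m^2)) v) / (1 - v)"
    using assms(3) by (simp add: U_def field_simps)
  then show ?thesis
    unfolding w_of_def alpha0_Rv[OF assms] centrifugal_Rv[OF assms] sqrt_lapse(3)[OF assms(2,3)]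
    by (simp add: real_sqrt_divide)
qed

lemma Omega_int_eq:
  assumes m: "m > 0" and M: "M > 16 * m^2" and ab: "0 < a" "a < b" "a + 2 * b < 1" "b < 1 / 2"
    and Ua: "U (M / (4 * m^2)) a = h^2" and Ub: "U (M / (4 * m^2)) b = h^2" and h: "h > 0"
    and z: "z = ((a + b) / 2, (b - a) / 2)"
  shows "Omega_int m h M = pi / (2 * m * (h * period (1 - h^2) (M / (4 * m^2)) z))"
proof -
  define L where "L = M / (4 * m^2)"
  define c where "c = 1 - a - b"
  have "M > 0" using M zero_le_power2[of m] by linarith
  then have L: "L > 0" using m by (simp add: L_def)
  have bc: "b < c" using ab by (simp add: c_def)
  note cf = cubic_factor[OF less_imp_neq[OF ab(2)] Ua Ub, folded L_def c_def]
  note im = orb_image[OF ab(1,2) _ m z]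
  let ?f = "\<lambda>R. A0 m R * h / ((alpha0 m R)^2 * w_of m R h M)"
  let ?k = "\<lambda>x. 1 / ((orb z x)^2 * (1 - orb z x) * sqrt (L * (c - orb z x)))"
  define g' where "g' x = m * (snd z * sin x) / (2 * sqrt (1 - orb z x) * (1 - sqrt (1 - orb z x))^2)" for x
  have bd: "a < orb z x" "orb z x < b" if "x \<in> {0<..<pi}" for x
    using im(3)[OF _ that] ab by auto
  have eq: "\<bar>g' x\<bar> * ?f (Rv m (orb z x)) = 2 * m * h * ?k x" if x: "x \<in> {0<..<pi}" for x
  proof -
    define v where "v = orb z x"
    define \<beta> where "\<beta> = sqrt (1 - v)"
    define s where "s = snd z * sin x"
    define r where "r = sqrt (L * (c - v))"
    have v: "0 < v" "v < 1" "v < c" using bd[OF x] ab bc by (auto simp: v_def)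
    have \<beta>: "0 < \<beta>" "\<beta> < 1" "\<beta>^2 = 1 - v" using v by (auto simp: \<beta>_def)
    have s: "s > 0" using x ab sin_gt_zero by (auto simp: s_def z)
    have r: "r > 0" using v L by (simp add: r_def)
    \<comment> \<open>The quantity \<open>s\<close> is both the factor \<open>q sin x\<close> of the
      Jacobian and the root of the two vanishing factors of \<open>h^2 - U L v\<close>; it cancels,
      and the endpoint singularities with it.\<close>
    have s2: "(v - a) * (b - v) = s^2"
    proof -
      have v': "v = (a + b) / 2 + (b - a) / 2 * cos x" by (simp add: v_def orb_def z)
      have "(v - a) * (b - v) = ((b - a) / 2)^2 * (1 - (cos x)^2)"
        unfolding v' by (simp add: field_simps power2_eq_square)
      also have "\<dots> = s^2" unfolding sin_squared_eq[symmetric] by (simp add: s_def z power_divide power_mult_distrib)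
      finally show ?thesis .
    qed
    have "sqrt (h^2 - U L v) = s * r"
    proof -
      have "h^2 - U L v = s^2 * (L * (c - v))"
        unfolding cf(1) c_def[symmetric] s2[symmetric] by (simp add: mult_ac)
      then show ?thesis using s by (simp add: r_def real_sqrt_mult)
    qed
    then have w: "w_of m (Rv m v) h M = s * r / \<beta>"
      unfolding w_of_Rv[OF m v(1,2)] L_def[symmetric] \<beta>_def by simp
    have g: "\<bar>g' x\<bar> = m * s / (2 * \<beta> * (1 - \<beta>)^2)"
      unfolding g'_def v_def[symmetric] \<beta>_def[symmetric] s_def[symmetric] using m s \<beta> by simp
    have v\<beta>: "v = (1 - \<beta>) * (1 + \<beta>)" using \<beta>(3) by (simp add: algebra_simps power2_eq_square)
    have "m * s / (2 * \<beta> * X^2) * (4 / Y^2 * h / (\<beta>^2 * (s * r / \<beta>))) = 2 * m * h * (1 / ((X * Y)^2 * \<beta>^2 * r))"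
      if "X > 0" "Y > 0" for X Y
      using that \<beta>(1) s r by (simp add: field_simps power2_eq_square)
    from this[of "1 - \<beta>" "1 + \<beta>"] \<beta>(1,2)
    have "m * s / (2 * \<beta> * (1 - \<beta>)^2) * (4 / (1 + \<beta>)^2 * h / (\<beta>^2 * (s * r / \<beta>)))
       = 2 * m * h * (1 / (v^2 * \<beta>^2 * r))"
      unfolding v\<beta>[symmetric] by simp
    then show ?thesis
      unfolding v_def[symmetric] g w A0_Rv(1)[OF m v(1,2)] alpha0_Rv[OF m v(1,2)] \<beta>_def[symmetric] r_def[symmetric]
      using \<beta>(3) by simp
  qed
  have "(?k has_integral period (1 - h^2) L z) {0..pi}"
    by (rule period_eq[OF ab(1,2) c_def bc L cf(2,3) z])
  from has_integral_mult_right[OF this, of "2 * m * h"]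
  have I: "((\<lambda>x. 2 * m * h * ?k x) has_integral 2 * m * h * period (1 - h^2) L z) {0<..<pi}"
    using has_integral_Icc_iff_Ioo by blast
  \<comment> \<open>The change of variables asks for absolute integrability, which is automatic for
    a nonnegative integrable function.\<close>
  then have "(\<lambda>x. 2 * m * h * ?k x) absolutely_integrable_on {0<..<pi}"
  proof (intro nonnegative_absolutely_integrable_1)
    fix x assume x: "x \<in> {0<..<pi}"
    show "0 \<le> 2 * m * h * ?k x"
      unfolding eq[OF x, symmetric] using bd[OF x] h m ab L bc
      by (subst eq[OF x]) (auto intro!: mult_nonneg_nonneg divide_nonneg_nonneg)
  qed (auto simp: has_integral_integrable)
  then have "(\<lambda>x. \<bar>g' x\<bar> * ?f (Rv m (orb z x))) absolutely_integrable_on {0<..<pi} \<and>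
     integral {0<..<pi} (\<lambda>x. \<bar>g' x\<bar> * ?f (Rv m (orb z x))) = 2 * m * h * period (1 - h^2) L z"
    using integral_unique[OF I] set_integrable_cong[of lebesgue lebesgue "{0<..<pi}" "{0<..<pi}" "\<lambda>x. \<bar>g' x\<bar> * ?f (Rv m (orb z x))" "\<lambda>x. 2 * m * h * ?k x"]
      Henstock_Kurzweil_Integration.integral_cong[of "{0<..<pi}" "\<lambda>x. \<bar>g' x\<bar> * ?f (Rv m (orb z x))" "\<lambda>x. 2 * m * h * ?k x"] eq
    by auto
  moreover have "((\<lambda>x. Rv m (orb z x)) has_real_derivative g' x) (at x within {0<..<pi})" if "x \<in> {0<..<pi}" for x
    unfolding g'_def using bd[OF that] ab by (intro Rv_orb_has_derivative) auto
  ultimately have "integral ((\<lambda>x. Rv m (orb z x)) ` {0<..<pi}) ?f = 2 * m * h * period (1 - h^2) L z"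
    using has_absolute_integral_change_of_variables_1'[of "{0<..<pi}" "\<lambda>x. Rv m (orb z x)" g' ?f "2 * m * h * period (1 - h^2) L z"]
      im(2) ab by auto
  then have "integral {Rv m b..Rv m a} ?f = 2 * m * h * period (1 - h^2) L z"
    using im(1) ab by (simp add: integral_open_interval_real)
  then show ?thesis
    unfolding Omega_int_def turning_points(1,2)[OF m M ab(1,2,4) Ua Ub] L_def by simp
qed

subsection \<open>Dependence of the turning points on the parameters\<close>

lemma isCont_tendsto_nhds: "isCont f x \<Longrightarrow> (f \<longlongrightarrow> f x) (nhds x)"
  by (simp add: isCont_def tendsto_at_iff_tendsto_nhds)

lemma eventually_nhds_imp_at: "\<forall>\<^sub>F x in nhds a. P x \<Longrightarrow> \<forall>\<^sub>F x in at a within S. P x"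
  by (auto simp: eventually_at_filter elim: eventually_mono)

lemma turning_v_unique:
  assumes L: "L > 4" and ab: "0 < a" "a < b" "b \<le> 1 / 2" "U L a = k" "U L b = k"
    and ab': "0 < a'" "a' < b'" "b' \<le> 1 / 2" "U L a' = k" "U L b' = k"
  shows "a = a'" "b = b'"
proof -
  have side: "x < v_min L \<and> v_min L < y" if "0 < x" "x < y" "y \<le> 1 / 2" "U L x = k" "U L y = k" for x y
    using U_dec[OF L, of x y] U_inc[OF L, of x y] that by (auto simp: not_less[symmetric])
  show "a = a'"
    using side[OF ab] side[OF ab'] U_dec[OF L, of a a'] U_dec[OF L, of a' a] ab ab'
    by (cases a a' rule: linorder_cases) auto
  show "b = b'"
    using side[OF ab] side[OF ab'] U_inc[OF L, of b b'] U_inc[OF L, of b' b] ab ab'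
    by (cases b b' rule: linorder_cases) auto
qed

definition turning_v :: "real \<Rightarrow> real \<Rightarrow> real \<times> real" where
  "turning_v L k = (THE z. 0 < fst z \<and> fst z < snd z \<and> snd z < 1 / 2 \<and> U L (fst z) = k \<and> U L (snd z) = k)"

lemma turning_v_eq:
  assumes "L > 4" "0 < a" "a < b" "b < 1 / 2" "U L a = k" "U L b = k"
  shows "turning_v L k = (a, b)"
  unfolding turning_v_def
proof (rule the_equality)
  fix z assume "0 < fst z \<and> fst z < snd z \<and> snd z < 1 / 2 \<and> U L (fst z) = k \<and> U L (snd z) = k"
  then show "z = (a, b)"
    using turning_v_unique[of L "fst z" "snd z" k a b] assms by (simp add: prod_eq_iff)
qed (use assms in simp)

text \<open>A sign change of \<open>U (L x) v - k x\<close> between \<open>v = u1\<close> and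
  \<open>v = u2\<close> is an open condition in \<open>x\<close>; the intermediate value theorem
  then gives a root.\<close>

lemma root_persists:
  fixes L k :: "real \<Rightarrow> real"
  assumes "isCont L x0" "isCont k x0" "u1 < u2"
    and "(U (L x0) u1 - k x0) * (U (L x0) u2 - k x0) < 0"
  shows "\<forall>\<^sub>F x in nhds x0. \<exists>v. u1 < v \<and> v < u2 \<and> U (L x) v = k x"
proof -
  have "isCont (\<lambda>x. (U (L x) u1 - k x) * (U (L x) u2 - k x)) x0"
    unfolding U_def by (intro continuous_intros assms)
  then have "\<forall>\<^sub>F x in nhds x0. (U (L x) u1 - k x) * (U (L x) u2 - k x) < 0"
    using assms(4) by (rule order_tendstoD(2)[OF isCont_tendsto_nhds])
  then show ?thesis
  proof eventually_elim
    case (elim x)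
    have c: "continuous_on {u1..u2} (U (L x))" unfolding U_def by (intro continuous_intros)
    have "\<exists>v. u1 \<le> v \<and> v \<le> u2 \<and> U (L x) v = k x"
      using elim assms(3) IVT'[of "U (L x)" u1 "k x" u2] IVT2'[of "U (L x)" u2 "k x" u1] c
      unfolding mult_less_0_iff by auto
    then obtain v where v: "u1 \<le> v" "v \<le> u2" "U (L x) v = k x" by blast
    then have "v \<noteq> u1" "v \<noteq> u2" using elim by auto
    then show ?case using v by (intro exI[of _ v]) auto
  qed
qed

lemma turning_v_near:
  fixes L k :: "real \<Rightarrow> real"
  assumes c: "isCont L x0" "isCont k x0" and L: "L x0 > 4"
    and ab: "0 < a" "a < b" "b < 1 / 2" "U (L x0) a = k x0" "U (L x0) b = k x0"
    and \<eta>: "\<eta> > 0"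
  shows "\<forall>\<^sub>F x in nhds x0. \<exists>a' b'. turning_v (L x) (k x) = (a', b') \<and> \<bar>a' - a\<bar> < \<eta> \<and> \<bar>b' - b\<bar> < \<eta>
     \<and> 0 < a' \<and> a' < b' \<and> b' < 1 / 2 \<and> U (L x) a' = k x \<and> U (L x) b' = k x \<and> L x > 4"
proof -
  define vm where "vm = v_min (L x0)"
  have side: "a < vm" "vm < b"
    using U_dec[OF L, of a b] U_inc[OF L, of a b] ab by (auto simp: vm_def not_less[symmetric])
  \<comment> \<open>Small enough for the brackets of radius \<open>e\<close> around \<open>a\<close>
    and \<open>b\<close> to lie in \<open>(0, vm)\<close> and \<open>(vm, 1 / 2)\<close>, where
    \<open>U (L x0)\<close> is strictly monotone and so passes through \<open>k x0\<close> with a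
    sign change.\<close>
  define e where "e = Min {\<eta>, a, vm - a, b - vm, 1 / 2 - b} / 2"
  have "0 < Min {\<eta>, a, vm - a, b - vm, 1 / 2 - b}" using \<eta> ab side by simp
  moreover have "Min {\<eta>, a, vm - a, b - vm, 1 / 2 - b} \<le> y" if "y \<in> {\<eta>, a, vm - a, b - vm, 1 / 2 - b}" for y
    using that by (intro Min_le) auto
  ultimately have e: "0 < e" "e < \<eta>" "e < a" "e < vm - a" "e < b - vm" "e < 1 / 2 - b"
    unfolding e_def by (smt (verit) field_sum_of_halves insertCI)+
  have "U (L x0) (a - e) > k x0" "U (L x0) (a + e) < k x0"
    using U_dec[OF L, of "a - e" a] U_dec[OF L, of a "a + e"] e ab by (auto simp: vm_def)
  then have ra: "\<forall>\<^sub>F x in nhds x0. \<exists>v. a - e < v \<and> v < a + e \<and> U (L x) v = k x"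
    using e by (intro root_persists c) (auto simp: mult_less_0_iff)
  have "U (L x0) (b - e) < k x0" "U (L x0) (b + e) > k x0"
    using U_inc[OF L, of "b - e" b] U_inc[OF L, of b "b + e"] e ab by (auto simp: vm_def)
  then have rb: "\<forall>\<^sub>F x in nhds x0. \<exists>v. b - e < v \<and> v < b + e \<and> U (L x) v = k x"
    using e by (intro root_persists c) (auto simp: mult_less_0_iff)
  have rL: "\<forall>\<^sub>F x in nhds x0. L x > 4"
    using c(1) L by (rule order_tendstoD(1)[OF isCont_tendsto_nhds])
  show ?thesis
    using ra rb rL
  proof eventually_elim
    case (elim x)
    then obtain a' b' where *: "a - e < a'" "a' < a + e" "U (L x) a' = k x" "b - e < b'" "b' < b + e" "U (L x) b' = k x"
      by blast
    moreover have "0 < a'" "a' < b'" "b' < 1 / 2" using * e by linarith+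
    moreover have "turning_v (L x) (k x) = (a', b')"
      using elim(3) * calculation by (intro turning_v_eq)
    moreover have "\<bar>a' - a\<bar> < \<eta>" "\<bar>b' - b\<bar> < \<eta>" using * e by linarith+
    ultimately show ?case using elim(3) by blast
  qed
qed

text \<open>\<open>D\<close> is the divided difference of the cubic in \<open>v\<close>, a
  polynomial. It exhibits the difference quotient of \<open>v\<close> as those of \<open>k\<close>
  and \<open>L\<close> combined over \<open>D x\<close>, so continuity of \<open>v\<close> suffices
  for the limit. Only existence is kept: the rates needed later follow from differentiating Vieta's
  relations.\<close>

lemma root_has_derivative:
  fixes L k v :: "real \<Rightarrow> real"
  assumes L: "(L has_real_derivative L') (at x0)" and k: "(k has_real_derivative k') (at x0)"
    and v: "isCont v x0" and eq: "\<forall>\<^sub>F x in nhds x0. U (L x) (v x) = k x"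
    and ne: "-1 + 2 * L x0 * v x0 - 3 * L x0 * (v x0)^2 \<noteq> 0"
  shows "\<exists>v'. (v has_real_derivative v') (at x0)"
proof -
  define D where "D x = -1 + L x * (v x + v x0) - L x * ((v x)^2 + v x * v x0 + (v x0)^2)" for x
  define l where "l = (k' - L' * ((1 - v x0) * (v x0)^2)) / D x0"
  have Lc: "isCont L x0" using L by (rule DERIV_isCont)
  have Dc: "isCont D x0" unfolding D_def by (intro continuous_intros Lc v)
  have D0: "D x0 \<noteq> 0" using ne by (simp add: D_def power2_eq_square algebra_simps)
  have eq0: "U (L x0) (v x0) = k x0" using eq by (rule eventually_nhds_x_imp_x)
  have "((\<lambda>x. ((k x - k x0) / (x - x0) - (L x - L x0) / (x - x0) * ((1 - v x0) * (v x0)^2)) / D x) \<longlongrightarrow> l) (at x0)"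
    unfolding l_def
    using L k Dc D0 by (intro tendsto_intros) (auto simp: has_field_derivative_iff isCont_def)
  moreover have "\<forall>\<^sub>F x in at x0. D x \<noteq> 0"
    using Dc D0 unfolding isCont_def by (rule tendsto_imp_eventually_ne)
  then have "\<forall>\<^sub>F x in at x0. ((k x - k x0) / (x - x0) - (L x - L x0) / (x - x0) * ((1 - v x0) * (v x0)^2)) / D x
      = (v x - v x0) / (x - x0)"
    using eventually_nhds_imp_at[OF eq]
  proof eventually_elim
    case (elim x)
    have "k x - k x0 = (v x - v x0) * D x + (L x - L x0) * ((1 - v x0) * (v x0)^2)"
      unfolding elim(2)[symmetric] eq0[symmetric] U_def D_def by algebra
    then have "((k x - k x0) / (x - x0) - (L x - L x0) / (x - x0) * ((1 - v x0) * (v x0)^2)) = (v x - v x0) * D x / (x - x0)"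
      by (simp add: add_divide_distrib)
    then show ?case using elim(1) by simp
  qed
  ultimately have "((\<lambda>x. (v x - v x0) / (x - x0)) \<longlongrightarrow> l) (at x0)"
    by (rule Lim_transform_eventually)
  then show ?thesis by (auto simp: has_field_derivative_iff)
qed

lemma turning_v_has_derivative:
  fixes L k :: "real \<Rightarrow> real"
  assumes L: "(L has_real_derivative L') (at x0)" and k: "(k has_real_derivative k') (at x0)" and L4: "L x0 > 4"
    and ab: "0 < a" "a < b" "b < 1 / 2" "U (L x0) a = k x0" "U (L x0) b = k x0"
  obtains a' b' where "((\<lambda>x. fst (turning_v (L x) (k x))) has_real_derivative a') (at x0)"
    "((\<lambda>x. snd (turning_v (L x) (k x))) has_real_derivative b') (at x0)"
proof -
  note near = turning_v_near[OF DERIV_isCont[OF L] DERIV_isCont[OF k] L4 ab]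
  have t0: "turning_v (L x0) (k x0) = (a, b)" using L4 ab by (intro turning_v_eq)
  have side: "a < v_min (L x0)" "v_min (L x0) < b"
    using U_dec[OF L4, of a b] U_inc[OF L4, of a b] ab by (auto simp: not_less[symmetric])
  note vb = v_min_bounds[OF L4]
  have "isCont (\<lambda>x. fst (turning_v (L x) (k x))) x0" "isCont (\<lambda>x. snd (turning_v (L x) (k x))) x0"
    unfolding isCont_def t0 tendsto_iff dist_real_def
    by (auto intro!: eventually_nhds_imp_at elim!: eventually_mono[OF near])
  moreover have "\<forall>\<^sub>F x in nhds x0. U (L x) (fst (turning_v (L x) (k x))) = k x"
    "\<forall>\<^sub>F x in nhds x0. U (L x) (snd (turning_v (L x) (k x))) = k x"
    using near[of 1] by (auto elim!: eventually_mono)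
  moreover have "-1 + 2 * L x0 * v - 3 * L x0 * v^2 \<noteq> 0" if "v \<in> {a, b}" for v
    unfolding U_deriv_factor[OF L4] using side vb ab L4 that by auto
  ultimately show ?thesis
    using root_has_derivative[OF L k, of "\<lambda>x. fst (turning_v (L x) (k x))"]
      root_has_derivative[OF L k, of "\<lambda>x. snd (turning_v (L x) (k x))"] that t0 by auto
qed

lemma period_energy_deriv:
  assumes "E > 0"
  shows "((\<lambda>E. pi / sqrt E * (1 / (2 * E) + 1)) has_real_derivative
     - (pi * (3 / (4 * E^2 * sqrt E) + 1 / (2 * E * sqrt E)))) (at E)"
proof -
  have s: "sqrt E > 0" "E = sqrt E * sqrt E" using assms by auto
  have r: "(rsq has_real_derivative - (rsq E^3 / 2)) (at E)"
    unfolding has_field_derivative_def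
    by (rule has_derivative_eq_rhs[OF rsq_has_derivative[of "\<lambda>x. x" "\<lambda>h. h"]]) (use assms in auto)
  have "((\<lambda>E. pi * (rsq E * (1 / (2 * E) + 1))) has_real_derivative
     pi * (- (rsq E^3 / 2) * (1 / (2 * E) + 1) + (- (1 / (2 * E^2))) * rsq E)) (at E)"
    using assms by (intro DERIV_cmult DERIV_mult r) (auto intro!: derivative_eq_intros simp: power2_eq_square field_simps)
  moreover have "rsq E^3 = rsq E / E"
    using assms by (simp add: rsq_def power3_eq_cube)
  then have "pi * (- (rsq E^3 / 2) * (1 / (2 * E) + 1) + (- (1 / (2 * E^2))) * rsq E)
     = - (pi * (3 / (4 * E^2 * sqrt E) + 1 / (2 * E * sqrt E)))"
    using assms by (simp add: rsq_def power2_eq_square field_simps)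
  ultimately show ?thesis by (simp add: rsq_def)
qed

text \<open>The expression is the rate of \<open>period\<close> by the chain rule: \<open>e\<close>,
  \<open>l\<close>, \<open>p'\<close> are the rates of \<open>h^2\<close>, \<open>L\<close>,
  \<open>p\<close>, and \<open>w\<close> is \<open>q * q'\<close>; \<open>F\<close>,
  \<open>J\<close>, \<open>K\<close> are the \<open>p\<close>-derivative of the kernel integral, its
  \<open>q\<close>-derivative divided by \<open>q\<close>, and its value. Since \<open>F\<close> and
  \<open>J\<close> are nonnegative, \<open>e\<close> acts only favourably through \<open>p'\<close>
  and \<open>w\<close>. All losses are multiples of \<open>l\<close>, and these are paid by the
  Keplerian term because \<open>l * ((1 - a) * a^2) \<le> e\<close>.\<close>

lemma period_deriv_bound:
  fixes a b c L l e F J K :: real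
  assumes ab: "0 < a" "a < b" "b \<le> 0.17" and c: "c = 1 - a - b" and L: "L > 4" "L * (a * b + c * (a + b)) = 1"
    and l: "0 \<le> l" "l * ((1 - a) * a^2) \<le> e"
    and FJK: "F \<in> {0..pi * 32}" "J \<in> {0..pi * 32}" "K \<in> {0..pi * 5}"
    and E: "E = L * (a * b * c)"
    and p': "2 * (L * ((c - a) * (c - b))) * p' = e - (a + b) * c^2 * l"
    and w: "w = (1 - 3 * ((a + b) / 2)) * p' + l / (2 * L^2)"
  shows "0 \<le> e * (pi * (3 / (4 * E^2 * sqrt E) + 1 / (2 * E * sqrt E))) + (F * p' + w * J) / sqrt L - K * l / (2 * L * sqrt L)"
proof -
  have c1: "0.66 \<le> c" "c < 1" using ab c by auto
  have e0: "e \<ge> 0"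
  proof -
    have "0 \<le> l * ((1 - a) * a^2)" using l ab by (intro mult_nonneg_nonneg) auto
    then show ?thesis using l by linarith
  qed
  have sL: "sqrt L > 0" using L by simp
  have E0: "E > 0" using E L ab c1 by simp
  define \<Delta> where "\<Delta> = L * ((c - a) * (c - b))"
  \<comment> \<open>Both factors are at least \<open>1 - 3 * 0.17\<close>.\<close>
  have "0.49 * 0.49 \<le> (c - a) * (c - b)" using ab c by (intro mult_mono) auto
  then have "L * 0.24 \<le> L * ((c - a) * (c - b))" using L by (intro mult_left_mono) auto
  then have \<Delta>: "\<Delta> \<ge> 0.24 * L" by (simp add: \<Delta>_def mult.commute)
  have "0 < 0.24 * L" using L by simp
  then have \<Delta>0: "\<Delta> > 0" using \<Delta> by (rule less_le_trans)
  have Lc: "L * (c * (a + b)) \<le> 1"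
  proof -
    have "0 < L * (a * b)" using L ab by simp
    then show ?thesis using L(2) by (simp add: distrib_left)
  qed
  \<comment> \<open>The constant 2.1 is \<open>1 / (2 * 0.24)\<close> rounded up.\<close>
  have p'_ge: "p' \<ge> - (2.1 * l / L^2)"
  proof -
    have "(a + b) * c^2 * L \<le> 1"
    proof -
      have "(a + b) * c^2 * L = L * (c * (a + b)) * c" by (simp add: power2_eq_square)
      also have "\<dots> \<le> 1 * 1" using Lc c1 L ab by (intro mult_mono) auto
      finally show ?thesis by simp
    qed
    then have "(a + b) * c^2 \<le> 1 / L" using L by (simp add: field_simps)
    then have "(a + b) * c^2 * l \<le> 1 / L * l" using l by (intro mult_right_mono)
    then have "2 * \<Delta> * p' \<ge> - (l / L)" using p' e0 by (simp add: \<Delta>_def)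
    moreover have "2 * \<Delta> * (2.1 * l / L^2) \<ge> l / L"
    proof -
      have "l / L \<le> 2 * (0.24 * L) * (2.1 * l / L^2)" using L l by (simp add: field_simps power2_eq_square)
      also have "\<dots> \<le> 2 * \<Delta> * (2.1 * l / L^2)" using \<Delta> l by (intro mult_right_mono) auto
      finally show ?thesis .
    qed
    ultimately have "0 \<le> 2 * \<Delta> * (p' + 2.1 * l / L^2)" by (simp add: algebra_simps)
    then show ?thesis using \<Delta>0 by (simp add: zero_le_mult_iff)
  qed
  define B where "B = 2.1 * l / L^2"
  have B: "B \<ge> 0" using l by (simp add: B_def)
  have w_ge: "w \<ge> - B"
  proof -
    have "(1 - 3 * ((a + b) / 2)) * (- B) \<le> (1 - 3 * ((a + b) / 2)) * p'"
      using p'_ge ab by (intro mult_left_mono) (auto simp: B_def field_simps)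
    moreover have "(1 - 3 * ((a + b) / 2)) * B \<le> 1 * B" using ab B by (intro mult_right_mono) auto
    moreover have "l / (2 * L^2) \<ge> 0" using l by simp
    ultimately show ?thesis unfolding w by linarith
  qed
  have FJ: "F * p' + w * J \<ge> - (pi * 64 * B)"
  proof -
    have "F * (- B) \<le> F * p'" "J * (- B) \<le> J * w"
      using p'_ge[folded B_def] w_ge FJK by (intro mult_left_mono; simp)+
    moreover have "F * B \<le> pi * 32 * B" "J * B \<le> pi * 32 * B" using FJK B by (auto intro!: mult_right_mono)
    ultimately show ?thesis by (simp add: mult.commute)
  qed
  have B_le: "B \<le> 2.1 / 4 * (l / L)"
  proof -
    have "2.1 * l / L^2 \<le> 2.1 * l / (4 * L)"
      using L l by (intro divide_left_mono) (auto simp: power2_eq_square)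
    then show ?thesis by (simp add: B_def)
  qed
  \<comment> \<open>\<open>36.1 = 64 * 2.1 / 4 + 5 / 2\<close>, where 64 collects the bounds 32 of
    \<open>F\<close> and \<open>J\<close>, the division by 4 comes from \<open>L > 4\<close>, and
    \<open>5 / 2\<close> from \<open>K\<close>.\<close>
  have "- (36.1 * pi * (l / L)) \<le> (F * p' + w * J) - K * l / (2 * L)"
  proof -
    have "K * l / (2 * L) \<le> pi * 5 * l / (2 * L)" using FJK l L by (intro divide_right_mono mult_right_mono) auto
    moreover have "pi * 64 * B \<le> pi * 64 * (2.1 / 4 * (l / L))" using B_le by (intro mult_left_mono) auto
    moreover have "pi * (l / L) \<ge> 0" using l L by simp
    ultimately show ?thesis using FJ by (simp add: field_simps)
  qed
  then have lower: "- (36.1 * pi * (l / L)) / sqrt L \<le> ((F * p' + w * J) - K * l / (2 * L)) / sqrt L"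
    using sL by (intro divide_right_mono) auto
  \<comment> \<open>Because \<open>E = L * (a * b * c)\<close>, the factor \<open>a^2\<close> in
    \<open>E^2 * sqrt E\<close> cancels the one in the guaranteed rate \<open>(1 - a) * a^2\<close>,
    so small \<open>a\<close> does no harm. The rest is controlled by
    \<open>L * (c * (a + b)) \<le> 1\<close> and \<open>b^2 \<le> 0.17^2\<close>: numerically
    \<open>36.1 * 0.17^2 / 2 < 0.6 < 3 / 4 * 0.83\<close>.\<close>
  have key: "36.1 * (l / L) / sqrt L \<le> e * (3 / (4 * E^2 * sqrt E))"
  proof -
    have abc: "sqrt (a * b * c) \<le> (a + b) / 2"
    proof -
      have "a * b * c \<le> a * b * 1" using ab c1 by (intro mult_left_mono) auto
      also have "\<dots> \<le> ((a + b) / 2)^2" using sum_squares_ge_zero[of "a - b" 0] by (simp add: power2_eq_square field_simps)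
      finally show ?thesis using ab by (intro real_le_lsqrt) auto
    qed
    have "36.1 * (L * b^2 * c^2 * sqrt (a * b * c)) \<le> 0.6"
    proof -
      have "L * b^2 * c^2 * sqrt (a * b * c) \<le> L * b^2 * c^2 * ((a + b) / 2)"
        using abc L by (intro mult_left_mono) auto
      also have "\<dots> = (L * (c * (a + b))) * c * b^2 / 2" by (simp add: power2_eq_square)
      also have "\<dots> \<le> 1 * 1 * 0.17^2 / 2"
        using Lc c1 L ab by (intro divide_right_mono mult_mono power_mono) auto
      finally show ?thesis by (simp add: power2_eq_square)
    qed
    also have "0.6 \<le> 3 / 4 * (1 - a)" using ab by simp
    finally have "36.1 * (L * b^2 * c^2 * sqrt (a * b * c)) \<le> 3 / 4 * (1 - a)" .
    then have "l * a^2 * (36.1 * (L * b^2 * c^2 * sqrt (a * b * c))) \<le> l * a^2 * (3 / 4 * (1 - a))"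
      using l by (intro mult_left_mono) auto
    also have "\<dots> = 3 / 4 * (l * ((1 - a) * a^2))" by simp
    also have "\<dots> \<le> 3 / 4 * e" using l(2) by simp
    finally have 1: "36.1 * l * (L * a^2 * b^2 * c^2 * sqrt (a * b * c)) \<le> 3 / 4 * e" by (simp add: mult_ac)
    have "E^2 * sqrt E = (L * sqrt L) * (L * a^2 * b^2 * c^2 * sqrt (a * b * c))"
      unfolding E by (simp add: real_sqrt_mult power2_eq_square)
    then have 2: "36.1 * l / (L * sqrt L) * (E^2 * sqrt E) = 36.1 * l * (L * a^2 * b^2 * c^2 * sqrt (a * b * c))"
      using L sL by simp
    have "36.1 * l / (L * sqrt L) \<le> (3 / 4 * e) / (E^2 * sqrt E)"
      using 1 E0 by (subst pos_le_divide_eq, simp) (simp only: 2)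
    then show ?thesis by simp
  qed
  have "pi * (36.1 * (l / L) / sqrt L) \<le> pi * (e * (3 / (4 * E^2 * sqrt E)))"
    using key by (intro mult_left_mono) auto
  moreover have "0 \<le> e * (pi * (1 / (2 * E * sqrt E)))" using e0 E0 by simp
  ultimately show ?thesis using lower by (simp add: algebra_simps add_divide_distrib diff_divide_distrib)
qed

subsection \<open>Sign of the derivative of the period\<close>

lemma DERIV_ev_unique:
  assumes "(f has_real_derivative D) (at x)" "(g has_real_derivative D') (at x)" "\<forall>\<^sub>F y in nhds x. f y = g y"
  shows "D = D'"
proof -
  have "(g has_real_derivative D) (at x)"
    using assms(1) DERIV_cong_ev[OF refl assms(3) refl, of D] by simp
  then show ?thesis using assms(2) by (rule DERIV_unique)
qed

definition orbit :: "real \<Rightarrow> real \<Rightarrow> real \<times> real" where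
  "orbit L k = ((fst (turning_v L k) + snd (turning_v L k)) / 2, (snd (turning_v L k) - fst (turning_v L k)) / 2)"

text \<open>The rates of the two roots are never solved for individually. Differentiating Vieta's
  relations (\<open>G1\<close> and \<open>G2\<close>) gives a linear system for the rates of
  \<open>a + b\<close> and \<open>a * b\<close>; elimination leaves the factor
  \<open>(c - a) * (c - b)\<close>, which does not degenerate as \<open>a\<close> and
  \<open>b\<close> merge.\<close>

lemma period_curve:
  fixes L k :: "real \<Rightarrow> real"
  assumes L: "(L has_real_derivative l) (at x0)" and k: "(k has_real_derivative e) (at x0)" and L4: "L x0 > 4"
    and ab: "0 < a" "a < b" "b \<le> 0.17" "U (L x0) a = k x0" "U (L x0) b = k x0"
    and l: "0 \<le> l" "l * ((1 - a) * a^2) \<le> e"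
  shows "\<exists>N'\<ge>0. ((\<lambda>x. period (1 - k x) (L x) (orbit (L x) (k x))) has_real_derivative N') (at x0)"
proof -
  have b2: "b < 1 / 2" using ab(3) by simp
  define A where "A x = fst (turning_v (L x) (k x))" for x
  define B where "B x = snd (turning_v (L x) (k x))" for x
  obtain A' B' where A': "(A has_real_derivative A') (at x0)" and B': "(B has_real_derivative B') (at x0)"
    using turning_v_has_derivative[OF L k L4 ab(1,2) b2 ab(4,5)] unfolding A_def B_def by blast
  have "turning_v (L x0) (k x0) = (a, b)" using L4 ab b2 by (intro turning_v_eq)
  then have AB0: "A x0 = a" "B x0 = b" by (simp_all add: A_def B_def)
  define c where "c = 1 - a - b"
  define z where "z x = orbit (L x) (k x)" for x
  define E where "E = 1 - k x0"
  have L0: "L x0 > 0" using L4 by simp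
  note cf = cubic_factor(2,3)[OF less_imp_neq[OF ab(2)] ab(4,5), folded c_def E_def]
  have z_eq: "z x = ((A x + B x) / 2, (B x - A x) / 2)" for x by (simp add: z_def orbit_def A_def B_def)
  have z0: "z x0 = ((a + b) / 2, (b - a) / 2)" by (simp add: z_eq AB0)
  have near: "\<forall>\<^sub>F x in nhds x0. A x < B x \<and> U (L x) (A x) = k x \<and> U (L x) (B x) = k x"
    using turning_v_near[OF DERIV_isCont[OF L] DERIV_isCont[OF k] L4 ab(1,2) b2 ab(4,5), of 1]
    by (auto simp: A_def B_def elim!: eventually_mono)
  define S where "S = A' + B'"
  have G1: "l * (a * b + c * (a + b)) + L x0 * ((A' * b + a * B') + (c - (a + b)) * S) = 0"
  proof (rule DERIV_ev_unique)
    show "((\<lambda>x. L x * (A x * B x + (1 - A x - B x) * (A x + B x))) has_real_derivative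
      l * (a * b + c * (a + b)) + L x0 * ((A' * b + a * B') + (c - (a + b)) * S)) (at x0)"
      by (rule derivative_eq_intros L A' B' refl)+ (simp add: AB0 c_def S_def algebra_simps)
    show "((\<lambda>x. 1) has_real_derivative 0) (at x0)" by simp
    show "\<forall>\<^sub>F x in nhds x0. L x * (A x * B x + (1 - A x - B x) * (A x + B x)) = 1"
      using near
    proof eventually_elim
      case (elim x)
      then show ?case by (intro cubic_factor(2)[of "A x" "B x" "L x" "k x"]) auto
    qed
  qed
  have G2: "l * (a * b * c) + L x0 * ((A' * b + a * B') * c - a * b * S) = - e"
  proof (rule DERIV_ev_unique)
    show "((\<lambda>x. L x * (A x * B x * (1 - A x - B x))) has_real_derivative
      l * (a * b * c) + L x0 * ((A' * b + a * B') * c - a * b * S)) (at x0)"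
      by (rule derivative_eq_intros L A' B' refl)+ (simp add: AB0 c_def S_def algebra_simps)
    show "((\<lambda>x. 1 - k x) has_real_derivative - e) (at x0)"
      by (auto intro!: derivative_eq_intros k)
    show "\<forall>\<^sub>F x in nhds x0. L x * (A x * B x * (1 - A x - B x)) = 1 - k x"
      using near
    proof eventually_elim
      case (elim x)
      then show ?case by (intro cubic_factor(3)[of "A x" "B x" "L x" "k x", symmetric]) auto
    qed
  qed
  define p' where "p' = S / 2"
  define q' where "q' = (B' - A') / 2"
  define q where "q = (b - a) / 2"
  have pair: "a * b + c * (a + b) = 1 / L x0"
    using cf(1) L0 by (simp only: eq_divide_eq mult.commute[of _ "L x0"]) simp
  have abS: "A' * b + a * B' = - l / (L x0)^2 - (c - (a + b)) * S"
  proof -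
    have "l * (a * b + c * (a + b)) = l / L x0" unfolding pair by simp
    then have "L x0 * ((A' * b + a * B') + (c - (a + b)) * S) = - (l / L x0)" using G1 by linarith
    then show ?thesis using L0 by (simp add: field_simps power2_eq_square)
  qed
  have p'_eq: "2 * (L x0 * ((c - a) * (c - b))) * p' = e - (a + b) * c^2 * l"
  proof -
    have cab: "c * (a + b) = 1 / L x0 - a * b" using pair by linarith
    have "- e = l * (a * b * c) - c * (l / L x0) - L x0 * S * (c * (c - (a + b)) + a * b)"
      unfolding G2[symmetric] abS using L0 by (simp add: field_simps power2_eq_square)
    also have "c * (c - (a + b)) + a * b = (c - a) * (c - b)" by (simp add: algebra_simps)
    also have "l * (a * b * c) - c * (l / L x0) = - (c * (a + b)) * c * l"
      unfolding cab by (simp add: algebra_simps)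
    finally show ?thesis by (simp add: p'_def power2_eq_square algebra_simps)
  qed
  \<comment> \<open>Half the derivative of \<open>q^2 = (a + b)^2 / 4 - a * b\<close>.\<close>
  have w_eq: "q * q' = (1 - 3 * ((a + b) / 2)) * p' + l / (2 * (L x0)^2)"
  proof -
    have "q * q' = (a + b) * S / 4 - (A' * b + a * B') / 2"
      by (simp add: q_def q'_def S_def field_simps)
    also have "\<dots> = (a + b) * S / 4 + (l / (L x0)^2 + (1 - 2 * (a + b)) * S) / 2"
      unfolding abS by (simp add: c_def field_simps)
    also have "\<dots> = (1 - 3 * ((a + b) / 2)) * p' + l / (L x0)^2 / 2"
      by (simp add: p'_def field_simps)
    finally show ?thesis by (simp add: mult.commute)
  qed
  note adm = orb_bounds(1)[OF ab(1-3) z0]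
  define F where "F = integral {0..pi} (\<lambda>x. at_kernel kpoly_p (fst (z x0)) (orb (z x0) x) + at_kernel kpoly_v (fst (z x0)) (orb (z x0) x))"
  define J where "J = integral {0..pi} (\<lambda>x. (sin x)^2 * at_kernel kpoly_vv (fst (z x0)) (orb (z x0) x))"
  define K where "K = kint kpoly (z x0)"
  note kb = kernel_bounds[OF ab(1-3) z0]
  have s32: "(sin x)^2 * at_kernel kpoly_vv (fst (z x0)) (orb (z x0) x) \<in> {0..32}" for x
  proof -
    have "(sin x)^2 \<le> 1" by (simp add: sin_squared_eq)
    then have "(sin x)^2 * at_kernel kpoly_vv (fst (z x0)) (orb (z x0) x) \<le> 1 * 32"
      using kb(3)[of x] by (intro mult_mono) auto
    then show ?thesis using kb(3)[of x] by simp
  qed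
  have FJK: "F \<in> {0..pi * 32}" "J \<in> {0..pi * 32}" "K \<in> {0..pi * 5}"
    unfolding F_def J_def K_def kint_def
    by (rule integral_between[OF _ kb(2)] integral_between[OF _ s32] integral_between[OF _ kb(1)];
        intro continuous_intros kernel_orb_continuous adm)+
  have "(z has_derivative (\<lambda>h. (p' * h, q' * h))) (at x0)"
    unfolding z_eq[abs_def]
    using A' B' unfolding has_field_derivative_def
    by (auto intro!: derivative_eq_intros simp: p'_def q'_def S_def fun_eq_iff field_simps)
  from has_derivative_compose[OF this kint_has_derivative[OF adm]]
  have dK: "((\<lambda>x. kint kpoly (z x)) has_real_derivative F * p' + q * q' * J) (at x0)"
    unfolding has_field_derivative_def integral_cos_kernel_v[OF adm] F_def[symmetric] J_def[symmetric]
    by (rule has_derivative_eq_rhs) (simp add: fun_eq_iff z0 q_def algebra_simps)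
  have E0: "E > 0" unfolding cf(2) using ab L0 by (simp add: c_def)
  have dE: "((\<lambda>x. pi / sqrt (1 - k x) * (1 / (2 * (1 - k x)) + 1)) has_real_derivative
      - (pi * (3 / (4 * E^2 * sqrt E) + 1 / (2 * E * sqrt E))) * (0 - e)) (at x0)"
    using DERIV_chain2[OF period_energy_deriv[OF E0, unfolded E_def] DERIV_diff[OF DERIV_const k]]
    unfolding E_def by simp
  have sL: "sqrt (L x0) > 0" "sqrt (L x0) * sqrt (L x0) = L x0" using L0 by auto
  have dL: "((\<lambda>x. kint kpoly (z x) / sqrt (L x)) has_real_derivative
      ((F * p' + q * q' * J) * sqrt (L x0) - K * (inverse (sqrt (L x0)) / 2 * l)) / (sqrt (L x0) * sqrt (L x0))) (at x0)"
    unfolding K_def using sL by (intro DERIV_divide dK DERIV_chain2[OF DERIV_real_sqrt L] L0) auto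
  have "(X * r - K * (inverse r / 2 * l)) / (r * r) = X / r - K * l / (2 * (r * r) * r)" if "r > 0" for X r
    using that by (simp add: field_simps)
  from this[OF sL(1), of "F * p' + q * q' * J"]
  have e1: "((F * p' + q * q' * J) * sqrt (L x0) - K * (inverse (sqrt (L x0)) / 2 * l)) / (sqrt (L x0) * sqrt (L x0))
     = (F * p' + q * q' * J) / sqrt (L x0) - K * l / (2 * L x0 * sqrt (L x0))"
    unfolding sL(2) .
  have "((\<lambda>x. period (1 - k x) (L x) (z x)) has_real_derivative
     e * (pi * (3 / (4 * E^2 * sqrt E) + 1 / (2 * E * sqrt E)))
       + (F * p' + q * q' * J) / sqrt (L x0) - K * l / (2 * L x0 * sqrt (L x0))) (at x0)"
    unfolding period_def
  proof (rule DERIV_cong[OF DERIV_add[OF dE dL[unfolded e1]]])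
    show "- X * (0 - e) + (Y - Z) = e * X + Y - Z" for X Y Z :: real by simp
  qed
  moreover have "0 \<le> e * (pi * (3 / (4 * E^2 * sqrt E) + 1 / (2 * E * sqrt E)))
       + (F * p' + q * q' * J) / sqrt (L x0) - K * l / (2 * L x0 * sqrt (L x0))"
    by (rule period_deriv_bound[OF ab(1-3) c_def L4 cf(1) l FJK cf(2) p'_eq w_eq])
  ultimately show ?thesis unfolding z_def by blast
qed

lemma period_pos:
  assumes "0 < a" "a < b" "b \<le> 0.17" "z = ((a + b) / 2, (b - a) / 2)" "E > 0" "L > 0"
  shows "period E L z > 0"
proof -
  have "kint kpoly z \<in> {0..pi * 5}"
    unfolding kint_def
    by (intro integral_between kernel_bounds[OF assms(1-4)] kernel_orb_continuous orb_bounds(1)[OF assms(1-4)])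
  then have "kint kpoly z / sqrt L \<ge> 0" using assms by simp
  moreover have "pi / sqrt E * (1 / (2 * E) + 1) > 0" using assms by (intro mult_pos_pos add_pos_pos) auto
  ultimately show ?thesis by (simp add: period_def)
qed

text \<open>Near \<open>x0\<close>, \<open>Omega_Sch\<close> is \<open>pi / (2 * m)\<close> divided
  by \<open>h\<close> times the period. The rate of the period is nonnegative by
  \<open>period_curve\<close> and is dropped; the bound comes from the factor \<open>h\<close>
  alone. The curve form serves both derivatives of the theorem: \<open>h\<close> moving at fixed
  \<open>M\<close>, and \<open>M\<close> moving with \<open>h = H0 m R w M\<close>.\<close>

lemma Omega_Sch_curve:
  fixes h M :: "real \<Rightarrow> real"
  assumes m: "m > 0" and h: "(h has_real_derivative h') (at x0)" and M: "(M has_real_derivative M') (at x0)"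
    and M0: "M x0 > 16 * m^2" and h0: "h x0 > 0"
    and ab: "0 < a" "a < b" "b \<le> 0.17" "U (M x0 / (4 * m^2)) a = (h x0)^2" "U (M x0 / (4 * m^2)) b = (h x0)^2"
    and M': "0 \<le> M'" "M' / (4 * m^2) * ((1 - a) * a^2) \<le> 2 * h x0 * h'"
  defines "N \<equiv> period (1 - (h x0)^2) (M x0 / (4 * m^2)) ((a + b) / 2, (b - a) / 2)"
  shows "N > 0" "\<exists>D. ((\<lambda>x. Omega_Sch m (h x) (M x)) has_real_derivative D) (at x0) \<and> D \<le> - (pi * h' / (2 * m * (h x0)^2 * N))"
proof -
  define L where "L x = M x / (4 * m^2)" for x
  define k where "k x = (h x)^2" for x
  define P where "P x = period (1 - k x) (L x) (orbit (L x) (k x))" for x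
  have m4: "4 * m^2 > 0" using m by simp
  have L4: "L x0 > 4" using M0 m4 by (simp add: L_def pos_less_divide_eq)
  have dL: "(L has_real_derivative M' / (4 * m^2)) (at x0)" unfolding L_def by (rule DERIV_cdivide[OF M])
  have dk: "(k has_real_derivative 2 * h x0 * h') (at x0)"
    unfolding k_def by (auto intro!: derivative_eq_intros h)
  note ab' = ab(4,5)[folded L_def k_def]
  have b2: "b < 1 / 2" using ab(3) by simp
  have "turning_v (L x0) (k x0) = (a, b)" using L4 ab ab' b2 by (intro turning_v_eq)
  then have N: "N = P x0" unfolding P_def N_def by (simp add: orbit_def L_def k_def)
  have "1 - k x0 > 0"
    unfolding cubic_factor(3)[OF less_imp_neq[OF ab(2)] ab'] using ab L4 by simp
  then show N0: "N > 0"
    unfolding N_def using period_pos[OF ab(1-3) refl] L4 by (simp add: k_def L_def)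
  obtain N' where N': "N' \<ge> 0" "(P has_real_derivative N') (at x0)"
    using period_curve[OF dL dk L4 ab(1-3) ab'] M' m4 unfolding P_def by auto
  have near: "\<forall>\<^sub>F x in nhds x0. h x > 0"
    using order_tendstoD(1)[OF isCont_tendsto_nhds[OF DERIV_isCont[OF h]] h0] .
  have ev: "\<forall>\<^sub>F x in nhds x0. Omega_Sch m (h x) (M x) = pi / (2 * m) * inverse (h x * P x)"
    using turning_v_near[OF DERIV_isCont[OF dL] DERIV_isCont[OF dk] L4 ab(1,2) b2 ab', of "1/10", simplified] near
  proof eventually_elim
    case (elim x)
    then obtain a' b' where *: "turning_v (L x) (k x) = (a', b')" "\<bar>a' - a\<bar> < 1 / 10" "\<bar>b' - b\<bar> < 1 / 10"
      "0 < a'" "a' < b'" "b' < 1 / 2" "U (L x) a' = k x" "U (L x) b' = k x" "L x > 4" by auto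
    have Mx: "M x > 16 * m^2" using *(9) m4 by (simp add: L_def pos_less_divide_eq)
    have U: "U (M x / (4 * m^2)) a' = (h x)^2" "U (M x / (4 * m^2)) b' = (h x)^2"
      using *(7,8) by (simp_all add: L_def k_def)
    \<comment> \<open>The radius \<open>1 / 10\<close> raises \<open>a + 2 * b\<close>, at most
      0.51, by less than 0.3, so the perturbed roots still satisfy
      \<open>a' + 2 * b' < 1\<close>.\<close>
    have "b \<le> 17 / 100" using ab(3) by simp
    then have "a' + 2 * b' < 1" using *(2,3) ab(2) by linarith
    then have "Omega_int m (h x) (M x) = pi / (2 * m * (h x * P x))"
      using Omega_int_eq[OF m Mx *(4,5) _ *(6) U elim(2) refl] *(1)
      by (simp add: P_def orbit_def L_def k_def)
    \<comment> \<open>Strictness selects the integral branch of \<open>Omega_Sch\<close>.\<close>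
    moreover have "V_min m (M x) < (h x)^2" by (rule turning_points(3)[OF m Mx *(4-6) U])
    then have "Omega_Sch m (h x) (M x) = Omega_int m (h x) (M x)" by (simp add: Omega_Sch_def)
    moreover have "pi / (2 * m * X) = pi / (2 * m) * inverse X" for X by (simp add: field_simps)
    ultimately show ?case by (simp only:)
  qed
  have hP: "h x0 * P x0 > 0" using h0 N0 N by simp
  have dP: "((\<lambda>x. pi / (2 * m) * inverse (h x * P x)) has_real_derivative
      pi / (2 * m) * - (inverse (h x0 * P x0) * (h' * P x0 + N' * h x0) * inverse (h x0 * P x0))) (at x0)"
    using hP by (intro DERIV_cmult DERIV_inverse' DERIV_mult h N'(2)) auto
  note iffD2[OF DERIV_cong_ev[OF refl ev refl] dP]
  moreover have "pi / (2 * m) * - (inverse (h x0 * P x0) * (h' * P x0 + N' * h x0) * inverse (h x0 * P x0))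
     \<le> - (pi * h' / (2 * m * (h x0)^2 * N))"
  proof -
    have "pi / (2 * m) * (inverse (h x0 * P x0) * (h' * P x0 + 0) * inverse (h x0 * P x0))
      \<le> pi / (2 * m) * (inverse (h x0 * P x0) * (h' * P x0 + N' * h x0) * inverse (h x0 * P x0))"
      using m N0[unfolded N] N' h0 by (intro mult_left_mono mult_right_mono add_left_mono) auto
    moreover have "pi / (2 * m) * (inverse (h x0 * P x0) * (h' * P x0 + 0) * inverse (h x0 * P x0))
      = pi * h' / (2 * m * (h x0)^2 * N)"
      using h0 N0 m unfolding N by (simp add: field_simps power2_eq_square)
    ultimately show ?thesis by simp
  qed
  ultimately show "\<exists>D. ((\<lambda>x. Omega_Sch m (h x) (M x)) has_real_derivative D) (at x0) \<and> D \<le> - (pi * h' / (2 * m * (h x0)^2 * N))"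
    by blast
qed

subsection \<open>Membership in the monotonicity region\<close>

text \<open>Up to \<open>1 / (4 * m^2)\<close>, \<open>(1 - v) * v^2\<close> is the rate of
  \<open>h^2\<close> in \<open>l\<close> at position \<open>v\<close>; among all positions
  \<open>v \<ge> a\<close> it is smallest at the apocentre \<open>a\<close>. The proof factors out
  \<open>v - a\<close>.\<close>

lemma centrifugal_mono:
  assumes "0 \<le> a" "a \<le> v" "v \<le> (1 / 2 :: real)"
  shows "(1 - a) * a^2 \<le> (1 - v) * v^2"
proof -
  have "u * x \<le> 1 / 2 * x" if "u \<le> 1 / 2" "0 \<le> x" for u x :: real
    using that by (rule mult_right_mono)
  from this[of v v] this[of v a] this[of a a]
  have "v * v \<le> 1 / 2 * v" "v * a \<le> 1 / 2 * a" "a * a \<le> 1 / 2 * a"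
    using assms by linarith+
  then have "0 \<le> (v - a) * (v + a - v * v - v * a - a * a)" using assms by (intro mult_nonneg_nonneg) auto
  also have "\<dots> = (1 - v) * v^2 - (1 - a) * a^2" by (simp add: power2_eq_square algebra_simps)
  finally show ?thesis by simp
qed

text \<open>In the variable \<open>v\<close>, \<open>h^2 = (1 - v) * (1 + w^2 + L * v^2)\<close>
  with \<open>L = l / (4 * m^2)\<close>. Dropping \<open>w^2\<close> gives the first claim, which
  confines \<open>v\<close> to the region allowed at energy \<open>h\<close>.\<close>

lemma H0_curve:
  fixes w :: real
  assumes m: "m > 0" and v: "0 < v" "v \<le> 1 / 2" and l: "l > 0"
  defines "h \<equiv> H0 m (Rv m v) w l"
  shows "U (l / (4 * m^2)) v \<le> h^2"
    and "((\<lambda>x. H0 m (Rv m v) w x) has_real_derivative (1 - v) * v^2 / (4 * m^2) / (2 * h)) (at l)"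
proof -
  define \<beta> where "\<beta> = sqrt (1 - v)"
  define s where "s x = 1 + w^2 + v^2 / (4 * m^2) * x" for x
  have v1: "v < 1" using v by simp
  have \<beta>: "0 < \<beta>" "\<beta>^2 = 1 - v" using v by (auto simp: \<beta>_def)
  have H: "H0 m (Rv m v) w x = \<beta> * sqrt (s x)" for x
    unfolding H0_def centrifugal_Rv[OF m v(1) v1] alpha0_Rv[OF m v(1) v1] \<beta>_def s_def by (simp add: mult.commute)
  have s0: "s l > 0" unfolding s_def using l m by (intro add_pos_nonneg) auto
  have h: "h > 0" "h^2 = (1 - v) * s l" using \<beta> s0 by (auto simp: h_def H power_mult_distrib)
  show "U (l / (4 * m^2)) v \<le> h^2"
    unfolding h(2) U_def s_def using v by (intro mult_left_mono) (auto simp: mult.commute)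
  have ds: "(s has_real_derivative v^2 / (4 * m^2)) (at l)"
  proof -
    have "((\<lambda>x. 1 + w^2 + d * x) has_real_derivative d) (at l)" for d
      by (auto intro!: derivative_eq_intros)
    then show ?thesis unfolding s_def .
  qed
  have "((\<lambda>x. \<beta> * sqrt (s x)) has_real_derivative \<beta> * (inverse (sqrt (s l)) / 2 * (v^2 / (4 * m^2)))) (at l)"
    by (rule DERIV_cmult[OF DERIV_chain2[where g = s, OF DERIV_real_sqrt[OF s0] ds]])
  moreover have "\<beta> * (inverse (sqrt (s l)) / 2 * K) = (1 - v) * K / (2 * h)" for K
    using \<beta> s0 by (simp add: h_def H \<beta>(2)[symmetric] field_simps power2_eq_square)
  ultimately show "((\<lambda>x. H0 m (Rv m v) w x) has_real_derivative (1 - v) * v^2 / (4 * m^2) / (2 * h)) (at l)"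
    unfolding H by (simp only: times_divide_eq_right divide_divide_eq_left mult.commute[of "2 * h"])
qed

text \<open>Near \<open>M = 16 m\<^sup>2\<close> the conclusion fails for \<open>h\<close> close to \<open>1\<close>, where the inner turning point approaches
  the saddle at \<open>r = 4 m\<close>. The hypothesis \<open>h\<^sup>2 \<le> U L 0.17\<close> keeps it outside \<open>r = 2 m / 0.17\<close>,
  just inside the innermost stable circular orbit \<open>r = 12 m\<close>.\<close>

lemma S_0_memI:
  assumes m: "m > 0" and M: "M > 16 * m^2" and h: "h > 0" "V_min m M < h^2" "h^2 < 1"
    and in17: "h^2 \<le> U (M / (4 * m^2)) 0.17"
  shows "(h, M) \<in> S_0 m"
proof -
  define L where "L = M / (4 * m^2)"
  have m4: "4 * m^2 > 0" using m by simp
  have L4: "L > 4" using M m4 by (simp add: L_def pos_less_divide_eq)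
  have M0: "M > 0" using M zero_le_power2[of m] by linarith
  note vm = v_min_bounds[OF L4]
  have vm17: "v_min L < 0.17" using vm(2) by simp
  have Uvm: "U L (v_min L) < h^2" using h(2) V_min_eq[OF m M] by (simp add: L_def)
  have U0: "U L 0 = 1" by (simp add: U_def)
  have cont: "continuous_on X (U L)" for X unfolding U_def by (intro continuous_intros)
  obtain a where a: "0 \<le> a" "a \<le> v_min L" "U L a = h^2"
    using IVT2'[of "U L" "v_min L" "h^2" 0] Uvm U0 h(3) vm cont by auto
  obtain b where b: "v_min L \<le> b" "b \<le> 0.17" "U L b = h^2"
    using IVT'[of "U L" "v_min L" "h^2" "0.17"] Uvm in17 vm17 cont by (auto simp: L_def)
  have "a \<noteq> 0" "a \<noteq> v_min L" using a U0 h(3) Uvm by auto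
  then have ab: "0 < a" "a < b" "b \<le> 0.17" using a b by auto
  note Uab = a(3)[unfolded L_def] b(3)[unfolded L_def]
  define N where "N = period (1 - h^2) (M / (4 * m^2)) ((a + b) / 2, (b - a) / 2)"
  define C where "C = pi / (2 * m * h^2 * N)"
  define g where "g = (1 - a) * a^2 / (4 * m^2) / (2 * h)"
  have a1: "0 < (1 - a) * a^2" using ab by simp
  have A: "N > 0" "\<exists>D. ((\<lambda>x. Omega_Sch m x M) has_real_derivative D) (at h) \<and> D \<le> - (pi * 1 / (2 * m * h^2 * N))"
    using Omega_Sch_curve[of m "\<lambda>x. x" 1 h "\<lambda>_. M" 0 a b, folded N_def] m M h ab Uab
    by auto
  have C: "C > 0" using A(1) m h by (simp add: C_def)
  have g: "g > 0" unfolding g_def using a1 h m4 by (intro divide_pos_pos) auto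
  \<comment> \<open>The two slopes are at most \<open>- C\<close> and \<open>- (g * C)\<close>,
    where \<open>g\<close> is the apocentre value of the rate of \<open>h\<close> and hence a lower
    bound for it over all \<open>(R, w)\<close>. Halving makes the inequalities strict.\<close>
  define c where "c = min C (g * C) / 2"
  have c: "c > 0" "c < C" "c < g * C" using C g by (auto simp: c_def min_def)
  have "(h, M) \<in> S_b m" using h M by (simp add: S_b_def)
  moreover have "\<exists>D. ((\<lambda>k. Omega_Sch m k M) has_real_derivative D) (at h within {k. (k, M) \<in> S_b m}) \<and> D < - c"
  proof -
    obtain D where "((\<lambda>x. Omega_Sch m x M) has_real_derivative D) (at h)" "D \<le> - C"
      using A(2) by (auto simp: C_def)
    then show ?thesis using c(2) by (intro exI[of _ D]) (auto intro: has_field_derivative_at_within)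
  qed
  moreover have "\<exists>D. ((\<lambda>x. Omega_Sch m (H0 m R w x) x) has_real_derivative D) (at l) \<and> D < - c"
    if R: "R \<ge> R_star m" and l: "0 < l" "l = M" and H: "H0 m R w l = h" for R w l
  proof -
    obtain v where v: "0 < v" "v \<le> 1 / 2" "R = Rv m v" using Rv_surj[OF m R] by blast
    define h' where "h' = (1 - v) * v^2 / (4 * m^2) / (2 * h)"
    note curve = H0_curve[OF m v(1,2) l(1), of w, folded v(3), unfolded H]
    have "a \<le> v"
    proof (rule ccontr)
      assume "\<not> a \<le> v"
      then have "U L a < U L v" using U_dec[OF L4, of v a] v a by simp
      then show False using curve(1) a(3) by (simp add: L_def l(2))
    qed
    then have le: "(1 - a) * a^2 \<le> (1 - v) * v^2" using centrifugal_mono[of a v] a v by simp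
    then have gh: "g \<le> h'" unfolding g_def h'_def using h by (intro divide_right_mono) auto
    have "2 * h * h' = (1 - v) * v^2 / (4 * m^2)" using h by (simp add: h'_def)
    moreover have "1 / (4 * m^2) * ((1 - a) * a^2) \<le> (1 - v) * v^2 / (4 * m^2)"
      using divide_right_mono[OF le, of "4 * m^2"] by simp
    ultimately have "1 / (4 * m^2) * ((1 - a) * a^2) \<le> 2 * h * h'" by simp
    then obtain D where D: "((\<lambda>x. Omega_Sch m (H0 m R w x) x) has_real_derivative D) (at l)"
      "D \<le> - (pi * h' / (2 * m * h^2 * N))"
      using Omega_Sch_curve(2)[of m "H0 m R w" h' l "\<lambda>x. x" 1 a b, unfolded H, OF m curve(2)[folded h'_def]]
        M h ab Uab by (auto simp: N_def l(2))
    have "g * C \<le> h' * C" using gh C by (intro mult_right_mono) auto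
    also have "h' * C = pi * h' / (2 * m * h^2 * N)" by (simp add: C_def)
    finally show ?thesis using D c(3) by (intro exI[of _ D]) auto
  qed
  ultimately have "(h, M) \<in> S_c m c" unfolding S_c_def by blast
  then show ?thesis unfolding S_0_def using c(1) by blast
qed

theorem proposition2p5:
  fixes m :: real
  assumes "m > 0"
  shows "(\<exists>M0>0. \<forall>M>M0. \<forall>h>0. V_min m M < h^2 \<and> h^2 < 1 \<longrightarrow> (h, M) \<in> S_0 m) \<and>
         (\<forall>Mbar>16 * m^2. \<exists>\<delta>>0. \<forall>M h. 16 * m^2 < M \<and> M < Mbar \<and> 0 < h \<and>
            V_min m M < h^2 \<and> h^2 < V_min m M + \<delta> \<longrightarrow> (h, M) \<in> S_0 m)"
proof (intro conjI allI impI)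
  have m2: "m^2 > 0" using assms by simp
  show "\<exists>M0>0. \<forall>M>M0. \<forall>h>0. V_min m M < h^2 \<and> h^2 < 1 \<longrightarrow> (h, M) \<in> S_0 m"
  \<comment> \<open>This means \<open>L > 8\<close>. Already from about \<open>L = 7.1\<close> on,
    \<open>U L 0.17\<close> is at least 1, so \<open>h^2 < 1\<close> implies the condition on
    \<open>h^2\<close> in \<open>S_0_memI\<close>.\<close>
  proof (intro exI[of _ "32 * m^2"] conjI allI impI)
    fix M h assume M: "M > 32 * m^2" and h: "(h::real) > 0" "V_min m M < h^2 \<and> h^2 < 1"
    have "M / (4 * m^2) > 8" using M m2 by (simp add: pos_less_divide_eq)
    then have "1 \<le> U (M / (4 * m^2)) 0.17" by (simp add: U_def power2_eq_square)
    then show "(h, M) \<in> S_0 m"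
      using S_0_memI[OF assms _ h(1), of M] h M m2 by simp
  qed (use m2 in simp)
next
  fix Mbar assume Mbar: "Mbar > 16 * m^2"
  have m2: "m^2 > 0" using assms by simp
  have Mb0: "Mbar > 0" using Mbar m2 by linarith
  \<comment> \<open>The term \<open>m^2 / Mbar\<close> keeps \<open>h^2\<close> below 1. The term
    \<open>1 / 100000\<close> keeps it below \<open>U L 0.17\<close>: the excess of that over
    \<open>U L (1 / 6)\<close> grows with \<open>L\<close> and is about 0.000022 at
    \<open>L = 4\<close>.\<close>
  define \<delta> where "\<delta> = min (1 / 100000) (m^2 / Mbar)"
  show "\<exists>\<delta>>0. \<forall>M h. 16 * m^2 < M \<and> M < Mbar \<and> 0 < h \<and>
            V_min m M < h^2 \<and> h^2 < V_min m M + \<delta> \<longrightarrow> (h, M) \<in> S_0 m"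
  proof (intro exI[of _ \<delta>] conjI allI impI; (elim conjE)?)
    show "\<delta> > 0" using m2 Mb0 by (simp add: \<delta>_def)
    fix M h assume M: "16 * m^2 < M" "M < Mbar" and h: "0 < (h::real)" "V_min m M < h^2" "h^2 < V_min m M + \<delta>"
    define L where "L = M / (4 * m^2)"
    have L4: "L > 4" using M m2 by (simp add: L_def pos_less_divide_eq)
    have V: "V_min m M \<le> U L v" if "0 < v" "v \<le> 1 / 2" for v
      using U_min_le[OF L4 that] V_min_eq[OF assms M(1)] by (simp add: L_def)
    have M0: "M > 0" using M m2 by linarith
    have "h^2 < 1"
    proof -
      \<comment> \<open>The trial point minimises \<open>1 - v + L * v^2\<close>, the potential
        without its cubic term.\<close>
      have "V_min m M \<le> U L (1 / (2 * L))" using L4 by (intro V) (auto simp: field_simps)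
      also have "\<dots> = 1 - 1 / (4 * L) - 1 / (8 * L^2)"
        using L4 by (simp add: U_def field_simps power2_eq_square)
      also have "\<dots> \<le> 1 - 1 / (4 * L)" using L4 by simp
      also have "1 / (4 * L) = m^2 / M" using m2 by (simp add: L_def)
      also have "1 - m^2 / M \<le> 1 - m^2 / Mbar"
        using M m2 mult_pos_pos[OF Mb0 M0] by (intro diff_left_mono divide_left_mono) auto
      finally show ?thesis using h(3) by (simp add: \<delta>_def)
    qed
    moreover have "h^2 \<le> U L 0.17"
    proof -
      have "U L (1 / 6) + 1 / 100000 \<le> U L 0.17" using L4 by (simp add: U_def power2_eq_square field_simps)
      then show ?thesis using h(3) V[of "1 / 6"] by (simp add: \<delta>_def)
    qed
    ultimately show "(h, M) \<in> S_0 m" using S_0_memI[OF assms M(1) h(1,2)] by (simp add: L_def)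
  qed
qed

end
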